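(* Let $A=(A,\mathrm m,\Delta)$ be a bialgebra over a field $\mathbf k$ with counit $\varepsilon$, let $B\subseteq A$ be a subalgebra and let $I\subseteq B\cap\ker(\varepsilon)$ be an ideal of $B$. Suppose furthermore that $$\Delta(B)\subseteq B\otimes B+I\otimes A,\qquad \Delta(I)\subseteq B\otimes I+I\otimes A.$$ Then the bialgebra structure on $A$ induces a bialgebra structure on $B/I$.
   Context: "Ideal" means two-sided ideal; $\otimes$ is over $\mathbf k$. Induced structure: let $\pi:A\to A/I$ be the quotient map of vector spaces, so $B/I=\pi(B)\subseteq A/I$. The product on $B/I$ is the quotient algebra product, the counit is $\tilde\varepsilon(\pi(b))=\varepsilon(b)$, and the coproduct is $\tilde\Delta(\pi(b))=(\pi\otimes\pi)\Delta(b)$ for $b\in B$; part of the assertion is that $\tilde\Delta$ is well defined with values in $B/I\otimes B/I\subseteq A/I\otimes A/I$. *)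

theory Defs
  imports "HOL-Algebra.Subrings"
begin

section \<open>Vector spaces, algebras and quotients\<close>

abbreviation lin_span ::
  "('k, 'r) ring_scheme \<Rightarrow> ('k, 'v, 'm) module_scheme \<Rightarrow> 'v set \<Rightarrow> 'v set"
  where "lin_span K V S \<equiv> (\<lambda>N. submodule N K V) hull S"

text \<open>The locale \<^locale>\<open>algebra\<close> of the library is restricted to commutative algebras.\<close>

locale unital_algebra = K?: field K + module K A + ring A
  for K (structure) and A (structure) +
  assumes smult_mult_left:
      "\<lbrakk>k \<in> carrier K; x \<in> carrier A; y \<in> carrier A\<rbrakk> \<Longrightarrow>
        (k \<odot>\<^bsub>A\<^esub> x) \<otimes>\<^bsub>A\<^esub> y = k \<odot>\<^bsub>A\<^esub> (x \<otimes>\<^bsub>A\<^esub> y)"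
    and smult_mult_right:
      "\<lbrakk>k \<in> carrier K; x \<in> carrier A; y \<in> carrier A\<rbrakk> \<Longrightarrow>
        x \<otimes>\<^bsub>A\<^esub> (k \<odot>\<^bsub>A\<^esub> y) = k \<odot>\<^bsub>A\<^esub> (x \<otimes>\<^bsub>A\<^esub> y)"

text \<open>
  The quotient by a subspace \<open>N\<close>. The fields \<open>mult\<close> and \<open>one\<close> carry a meaning only if
  \<open>N\<close> is an ideal; otherwise the record is used only as a vector space.
\<close>

definition quotient_mod ::
  "('k, 'v, 'm) module_scheme \<Rightarrow> 'v set \<Rightarrow> ('k, 'v set) module"
  where "quotient_mod V N =
    ring.extend (V Quot N) (module.fields (\<lambda>k C. \<Union>x\<in>C. N +>\<^bsub>V\<^esub> (k \<odot>\<^bsub>V\<^esub> x)))"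

text \<open>
  The cosets in \<open>B/I\<close> are literally cosets in \<open>A/I\<close>, with the same operations, even if
  \<open>I\<close> is an ideal of \<open>B\<close> only.
\<close>

lemma quotient_mod_restrict_carrier:
  "quotient_mod (A\<lparr>carrier := B\<rparr>) I = (quotient_mod A I)\<lparr>carrier := (\<lambda>b. I +>\<^bsub>A\<^esub> b) ` B\<rparr>"
  by (auto simp: quotient_mod_def FactRing_def ring.defs module.defs A_RCOSETS_def' a_r_coset_def'
      rcoset_mult_def set_add_def' fun_eq_iff)


section \<open>Tensor products\<close>

text \<open>Finitely supported functions \<open>S \<rightarrow> K\<close>; there is no multiplication here.\<close>

definition free_module :: "('k, 'r) ring_scheme \<Rightarrow> 'x set \<Rightarrow> ('k, 'x \<Rightarrow> 'k) module"
  where "free_module K S =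
    \<lparr>carrier = {p. (\<forall>x. p x \<in> carrier K) \<and> (\<forall>x. x \<notin> S \<longrightarrow> p x = \<zero>\<^bsub>K\<^esub>) \<and>
                   finite {x. p x \<noteq> \<zero>\<^bsub>K\<^esub>}},
     monoid.mult = undefined, one = undefined,
     zero = (\<lambda>_. \<zero>\<^bsub>K\<^esub>),
     add = (\<lambda>p q x. p x \<oplus>\<^bsub>K\<^esub> q x),
     smult = (\<lambda>k p x. k \<otimes>\<^bsub>K\<^esub> p x)\<rparr>"

definition basis_vec :: "('k, 'r) ring_scheme \<Rightarrow> 'x \<Rightarrow> 'x \<Rightarrow> 'k"
  where "basis_vec K x = (\<lambda>y. if y = x then \<one>\<^bsub>K\<^esub> else \<zero>\<^bsub>K\<^esub>)"

abbreviation free_pairs ::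
  "('k, 'r) ring_scheme \<Rightarrow> ('k, 'v, 'm) module_scheme \<Rightarrow> ('k, 'w, 'n) module_scheme \<Rightarrow>
    ('k, 'v \<times> 'w \<Rightarrow> 'k) module"
  where "free_pairs K V W \<equiv> free_module K (carrier V \<times> carrier W)"

definition bilinear_rels ::
  "('k, 'r) ring_scheme \<Rightarrow> ('k, 'v, 'm) module_scheme \<Rightarrow> ('k, 'w, 'n) module_scheme \<Rightarrow>
    ('v \<times> 'w \<Rightarrow> 'k) set"
  where "bilinear_rels K V W = (let F = free_pairs K V W; \<delta> = basis_vec K in
      {\<delta> (v \<oplus>\<^bsub>V\<^esub> v', w) \<ominus>\<^bsub>F\<^esub> (\<delta> (v, w) \<oplus>\<^bsub>F\<^esub> \<delta> (v', w)) | v v' w.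
         v \<in> carrier V \<and> v' \<in> carrier V \<and> w \<in> carrier W} \<union>
      {\<delta> (v, w \<oplus>\<^bsub>W\<^esub> w') \<ominus>\<^bsub>F\<^esub> (\<delta> (v, w) \<oplus>\<^bsub>F\<^esub> \<delta> (v, w')) | v w w'.
         v \<in> carrier V \<and> w \<in> carrier W \<and> w' \<in> carrier W} \<union>
      {\<delta> (k \<odot>\<^bsub>V\<^esub> v, w) \<ominus>\<^bsub>F\<^esub> (k \<odot>\<^bsub>F\<^esub> \<delta> (v, w)) | k v w.
         k \<in> carrier K \<and> v \<in> carrier V \<and> w \<in> carrier W} \<union>
      {\<delta> (v, k \<odot>\<^bsub>W\<^esub> w) \<ominus>\<^bsub>F\<^esub> (k \<odot>\<^bsub>F\<^esub> \<delta> (v, w)) | k v w.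
         k \<in> carrier K \<and> v \<in> carrier V \<and> w \<in> carrier W})"

definition tensor_rel_space ::
  "('k, 'r) ring_scheme \<Rightarrow> ('k, 'v, 'm) module_scheme \<Rightarrow> ('k, 'w, 'n) module_scheme \<Rightarrow>
    ('v \<times> 'w \<Rightarrow> 'k) set"
  where "tensor_rel_space K V W = lin_span K (free_pairs K V W) (bilinear_rels K V W)"

definition tensor ::
  "('k, 'r) ring_scheme \<Rightarrow> ('k, 'v, 'm) module_scheme \<Rightarrow> ('k, 'w, 'n) module_scheme \<Rightarrow>
    ('k, ('v \<times> 'w \<Rightarrow> 'k) set) module"
  where "tensor K V W = quotient_mod (free_pairs K V W) (tensor_rel_space K V W)"

definition pure_tensor ::
  "('k, 'r) ring_scheme \<Rightarrow> ('k, 'v, 'm) module_scheme \<Rightarrow> ('k, 'w, 'n) module_scheme \<Rightarrow>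
    'v \<Rightarrow> 'w \<Rightarrow> ('v \<times> 'w \<Rightarrow> 'k) set"
  where "pure_tensor K V W v w =
    tensor_rel_space K V W +>\<^bsub>free_pairs K V W\<^esub> basis_vec K (v, w)"

text \<open>
  The linear map \<open>V \<otimes> W \<rightarrow> U\<close> induced by a bilinear map \<open>\<beta>\<close>: all representatives \<open>p\<close> of
  the tensor \<open>t\<close> yield the same value \<open>\<Sum> p(v,w) \<beta>(v,w)\<close>.
\<close>

definition tensor_lift ::
  "('k, 'r) ring_scheme \<Rightarrow> ('k, 'u, 'l) module_scheme \<Rightarrow> ('v \<Rightarrow> 'w \<Rightarrow> 'u) \<Rightarrow>
    ('v \<times> 'w \<Rightarrow> 'k) set \<Rightarrow> 'u"
  where "tensor_lift K U \<beta> t =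
    (THE u. \<forall>p\<in>t. u = finsum U (\<lambda>x. p x \<odot>\<^bsub>U\<^esub> \<beta> (fst x) (snd x)) {x. p x \<noteq> \<zero>\<^bsub>K\<^esub>})"

text \<open>\<open>f \<otimes> g\<close> with values in \<open>V \<otimes> W\<close>\<close>

definition tensor_map ::
  "('k, 'r) ring_scheme \<Rightarrow> ('k, 'v, 'm) module_scheme \<Rightarrow> ('k, 'w, 'n) module_scheme \<Rightarrow>
    ('a \<Rightarrow> 'v) \<Rightarrow> ('b \<Rightarrow> 'w) \<Rightarrow> ('a \<times> 'b \<Rightarrow> 'k) set \<Rightarrow> ('v \<times> 'w \<Rightarrow> 'k) set"
  where "tensor_map K V W f g =
    tensor_lift K (tensor K V W) (\<lambda>a b. pure_tensor K V W (f a) (g b))"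

definition tensor_assoc ::
  "('k, 'r) ring_scheme \<Rightarrow> ('k, 'u, 'l) module_scheme \<Rightarrow> ('k, 'v, 'm) module_scheme \<Rightarrow>
    ('k, 'w, 'n) module_scheme \<Rightarrow> (('u \<times> 'v \<Rightarrow> 'k) set \<times> 'w \<Rightarrow> 'k) set \<Rightarrow>
    ('u \<times> ('v \<times> 'w \<Rightarrow> 'k) set \<Rightarrow> 'k) set"
  where "tensor_assoc K U V W =
    (let T = tensor K U (tensor K V W) in
      tensor_lift K T (\<lambda>s w. tensor_lift K T
        (\<lambda>u v. pure_tensor K U (tensor K V W) u (pure_tensor K V W v w)) s))"

text \<open>For subspaces \<open>S\<close> of \<open>V\<close> and \<open>S'\<close> of \<open>W\<close>: \<open>S \<otimes> S'\<close> as a subspace of \<open>V \<otimes> W\<close>\<close>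

definition tensor_subspace ::
  "('k, 'r) ring_scheme \<Rightarrow> ('k, 'v, 'm) module_scheme \<Rightarrow> ('k, 'w, 'n) module_scheme \<Rightarrow>
    'v set \<Rightarrow> 'w set \<Rightarrow> ('v \<times> 'w \<Rightarrow> 'k) set set"
  where "tensor_subspace K V W S S' =
    lin_span K (tensor K V W) {pure_tensor K V W s s' | s s'. s \<in> S \<and> s' \<in> S'}"

text \<open>The multiplication determined by \<open>(a \<otimes> b) (c \<otimes> d) = ac \<otimes> bd\<close>\<close>

definition tensor_algebra ::
  "('k, 'r) ring_scheme \<Rightarrow> ('k, 'v, 'm) module_scheme \<Rightarrow> ('k, 'w, 'n) module_scheme \<Rightarrow>
    ('k, ('v \<times> 'w \<Rightarrow> 'k) set) module"
  where "tensor_algebra K A B = (tensor K A B)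
    \<lparr>monoid.mult := (\<lambda>s t. tensor_lift K (tensor K A B) (\<lambda>a b. tensor_lift K (tensor K A B)
        (\<lambda>c d. pure_tensor K A B (a \<otimes>\<^bsub>A\<^esub> c) (b \<otimes>\<^bsub>B\<^esub> d)) t) s),
     one := pure_tensor K A B \<one>\<^bsub>A\<^esub> \<one>\<^bsub>B\<^esub>\<rparr>"


section \<open>Bialgebras\<close>

text \<open>
  The counit axioms use the identifications \<open>K \<otimes> A = A = A \<otimes> K\<close>.
\<close>

locale bialgebra = unital_algebra K A
  for K :: "('k, 'r) ring_scheme" (structure)
    and A :: "('k, 'a, 'm) module_scheme" (structure) +
  fixes \<Delta> :: "'a \<Rightarrow> ('a \<times> 'a \<Rightarrow> 'k) set" and \<epsilon> :: "'a \<Rightarrow> 'k"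
  assumes comult_hom: "\<Delta> \<in> ring_hom A (tensor_algebra K A A)"
    and comult_smult:
      "\<lbrakk>k \<in> carrier K; a \<in> carrier A\<rbrakk> \<Longrightarrow> \<Delta> (k \<odot>\<^bsub>A\<^esub> a) = k \<odot>\<^bsub>tensor K A A\<^esub> \<Delta> a"
    and counit_hom: "\<epsilon> \<in> ring_hom A K"
    and counit_smult:
      "\<lbrakk>k \<in> carrier K; a \<in> carrier A\<rbrakk> \<Longrightarrow> \<epsilon> (k \<odot>\<^bsub>A\<^esub> a) = k \<otimes>\<^bsub>K\<^esub> \<epsilon> a"
    and coassoc:
      "a \<in> carrier A \<Longrightarrow>
        tensor_assoc K A A A (tensor_map K (tensor K A A) A \<Delta> id (\<Delta> a)) =
        tensor_map K A (tensor K A A) id \<Delta> (\<Delta> a)"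
    and counit_left: "a \<in> carrier A \<Longrightarrow> tensor_lift K A (\<lambda>x y. \<epsilon> x \<odot>\<^bsub>A\<^esub> y) (\<Delta> a) = a"
    and counit_right: "a \<in> carrier A \<Longrightarrow> tensor_lift K A (\<lambda>x y. \<epsilon> y \<odot>\<^bsub>A\<^esub> x) (\<Delta> a) = a"

end

theory Submission
  imports Defs
begin

text \<open>
  Choose a linear map \<open>r : A/I \<rightarrow> B/I\<close> that is the identity on \<open>B/I\<close>; it exists because \<open>B/I\<close> is a
  subspace over a field (\<open>linear_retraction\<close>). Two things follow. The map \<open>r \<otimes> r\<close> is a left inverse of
  \<open>\<iota> : B/I \<otimes> B/I \<rightarrow> A/I \<otimes> A/I\<close>, so \<open>\<iota>\<close> is injective (\<open>inj_on_tensor_map\<close>). And \<open>\<rho> = r \<circ> \<pi>\<close> is a linear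
  map from all of \<open>A\<close> to \<open>B/I\<close> that extends the quotient map \<open>B \<rightarrow> B/I\<close>. Hence the coproduct can be
  written down without inverting \<open>\<iota>\<close>: \<open>\<Delta>'(\<pi> b) = (\<rho> \<otimes> \<rho>)(\<Delta> b)\<close>. It does not depend on the
  representative \<open>b\<close>, since \<open>\<Delta>(I) \<subseteq> B \<otimes> I + I \<otimes> A\<close> and \<open>\<rho>\<close> vanishes on \<open>I\<close> (\<open>\<Phi>_comult_I\<close>); it does not
  depend on \<open>r\<close> either, since \<open>\<iota> (\<Delta>'(\<pi> b)) = (\<pi> \<otimes> \<pi>)(\<Delta> b)\<close>.

  Multiplicativity of \<open>\<Delta>'\<close>, coassociativity, the counit axioms and the equation for \<open>\<iota>\<close> all come down to
  linear maps on \<open>A \<otimes> A\<close> that agree at \<open>\<Delta> b\<close> for every \<open>b \<in> B\<close>. As \<open>\<Delta> b \<in> B \<otimes> B + I \<otimes> A\<close>, it suffices to compare them on pure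
  tensors \<open>x \<otimes> y\<close> with \<open>x, y \<in> B\<close> or with \<open>x \<in> I\<close> (\<open>comult_eqI\<close>). In the first case both sides are
  the same expression, because \<open>\<rho>\<close> is a homomorphism of algebras on \<open>B\<close> and \<open>\<Delta>'(\<rho> b) = (\<rho> \<otimes> \<rho>)(\<Delta> b)\<close>,
  \<open>\<epsilon>'(\<rho> b) = \<epsilon> b\<close>; in the second case both sides vanish, because \<open>\<rho> x = 0\<close>. In
  particular \<open>\<Delta>'\<close> is multiplicative (\<open>\<Phi>_mult\<close>) although \<open>\<rho> \<otimes> \<rho>\<close> need not be: \<open>I \<otimes> A\<close> absorbs products with
  elements of \<open>B \<otimes> B + I \<otimes> A\<close> since \<open>I\<close> is an ideal of \<open>B\<close>.

  These arguments take place in \<open>bialgebra_subquotient\<close>, where \<open>B/I\<close> is replaced by any algebra \<open>Q\<close> with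
  a suitable \<open>\<rho> : A \<rightarrow> Q\<close>. What precedes that locale is the universal property of the tensor product
  (\<open>linear_map_tensor_lift\<close>, \<open>tensor_lift_pure\<close>, \<open>tensor_eqI\<close>) and its consequences for \<open>f \<otimes> g\<close>, the
  associator and the multiplication of \<open>A \<otimes> A\<close>.
\<close>


section \<open>Linear and bilinear maps\<close>

definition linear_map ::
  "('k, 'r) ring_scheme \<Rightarrow> ('k, 'v, 'm) module_scheme \<Rightarrow> ('k, 'u, 'l) module_scheme \<Rightarrow>
    ('v \<Rightarrow> 'u) \<Rightarrow> bool"
  where "linear_map K V U f \<longleftrightarrow> f \<in> carrier V \<rightarrow> carrier U \<and>
    (\<forall>x\<in>carrier V. \<forall>y\<in>carrier V. f (x \<oplus>\<^bsub>V\<^esub> y) = f x \<oplus>\<^bsub>U\<^esub> f y) \<and>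
    (\<forall>k\<in>carrier K. \<forall>x\<in>carrier V. f (k \<odot>\<^bsub>V\<^esub> x) = k \<odot>\<^bsub>U\<^esub> f x)"

lemma linear_mapI:
  assumes "\<And>x. x \<in> carrier V \<Longrightarrow> f x \<in> carrier U"
    and "\<And>x y. x \<in> carrier V \<Longrightarrow> y \<in> carrier V \<Longrightarrow> f (x \<oplus>\<^bsub>V\<^esub> y) = f x \<oplus>\<^bsub>U\<^esub> f y"
    and "\<And>k x. k \<in> carrier K \<Longrightarrow> x \<in> carrier V \<Longrightarrow> f (k \<odot>\<^bsub>V\<^esub> x) = k \<odot>\<^bsub>U\<^esub> f x"
  shows "linear_map K V U f"
  using assms by (simp add: linear_map_def)

lemma linear_mapD:
  assumes "linear_map K V U f"
  shows linear_map_closed: "x \<in> carrier V \<Longrightarrow> f x \<in> carrier U"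
    and linear_map_add: "x \<in> carrier V \<Longrightarrow> y \<in> carrier V \<Longrightarrow> f (x \<oplus>\<^bsub>V\<^esub> y) = f x \<oplus>\<^bsub>U\<^esub> f y"
    and linear_map_smult: "k \<in> carrier K \<Longrightarrow> x \<in> carrier V \<Longrightarrow> f (k \<odot>\<^bsub>V\<^esub> x) = k \<odot>\<^bsub>U\<^esub> f x"
  using assms by (auto simp: linear_map_def)

lemma linear_map_zero:
  assumes "module K V" "module K U" "linear_map K V U f"
  shows "f \<zero>\<^bsub>V\<^esub> = \<zero>\<^bsub>U\<^esub>"
proof -
  interpret V: module K V by fact
  interpret U: module K U by fact
  have "f (\<zero>\<^bsub>K\<^esub> \<odot>\<^bsub>V\<^esub> \<zero>\<^bsub>V\<^esub>) = \<zero>\<^bsub>K\<^esub> \<odot>\<^bsub>U\<^esub> f \<zero>\<^bsub>V\<^esub>"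
    using assms(3) by (intro linear_map_smult) auto
  then show ?thesis
    using linear_map_closed[OF assms(3), of "\<zero>\<^bsub>V\<^esub>"] by simp
qed

lemma linear_map_uminus:
  assumes "module K V" "module K U" "linear_map K V U f" "x \<in> carrier V"
  shows "f (\<ominus>\<^bsub>V\<^esub> x) = \<ominus>\<^bsub>U\<^esub> f x"
proof -
  interpret V: module K V by fact
  interpret U: module K U by fact
  have "f (\<ominus>\<^bsub>V\<^esub> x) \<oplus>\<^bsub>U\<^esub> f x = f (\<ominus>\<^bsub>V\<^esub> x \<oplus>\<^bsub>V\<^esub> x)"
    using assms(3,4) by (simp add: linear_map_add)
  then have "f (\<ominus>\<^bsub>V\<^esub> x) \<oplus>\<^bsub>U\<^esub> f x = \<zero>\<^bsub>U\<^esub>"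
    using assms by (simp add: V.l_neg linear_map_zero)
  then show ?thesis
    using U.minus_equality linear_map_closed[OF assms(3)] assms(4) by (metis V.a_inv_closed)
qed

lemma linear_map_minus:
  assumes "module K V" "module K U" "linear_map K V U f" "x \<in> carrier V" "y \<in> carrier V"
  shows "f (x \<ominus>\<^bsub>V\<^esub> y) = f x \<ominus>\<^bsub>U\<^esub> f y"
proof -
  interpret V: module K V by fact
  show ?thesis
    using assms by (simp add: a_minus_def linear_map_add linear_map_uminus)
qed

lemma linear_map_id: "linear_map K V V (\<lambda>x. x)"
  by (rule linear_mapI) auto

lemma linear_map_const_zero:
  assumes "module K U"
  shows "linear_map K V U (\<lambda>_. \<zero>\<^bsub>U\<^esub>)"
proof -
  interpret U: module K U by fact
  show ?thesis by (rule linear_mapI) simp_all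
qed

lemma linear_map_comp:
  assumes "linear_map K V U f" "linear_map K U W g"
  shows "linear_map K V W (\<lambda>x. g (f x))"
  using assms by (intro linear_mapI) (simp_all add: linear_mapD)

lemma linear_map_pointwise_add:
  assumes "module K U" "linear_map K V U f" "linear_map K V U g"
  shows "linear_map K V U (\<lambda>x. f x \<oplus>\<^bsub>U\<^esub> g x)"
proof -
  interpret U: module K U by fact
  show ?thesis
    using assms(2,3) by (intro linear_mapI) (simp_all add: linear_mapD U.smult_r_distr U.a_ac)
qed

lemma linear_map_pointwise_smult:
  assumes "module K U" "linear_map K V U f" "k \<in> carrier K"
  shows "linear_map K V U (\<lambda>x. k \<odot>\<^bsub>U\<^esub> f x)"
proof -
  interpret U: module K U by fact
  show ?thesis
    using assms(2,3)
    by (intro linear_mapI)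
      (simp_all add: linear_mapD U.smult_r_distr U.smult_assoc1[symmetric] U.R.m_comm)
qed

lemma submodule_equalizer:
  assumes "module K V" "module K U" "linear_map K V U f" "linear_map K V U g"
  shows "submodule {x \<in> carrier V. f x = g x} K V"
proof -
  interpret V: module K V by fact
  interpret U: module K U by fact
  show ?thesis
    using assms
    by (intro V.submoduleI) (auto simp: linear_mapD linear_map_zero linear_map_uminus)
qed

lemma submodule_kernel:
  assumes "module K V" "module K U" "linear_map K V U f"
  shows "submodule {x \<in> carrier V. f x = \<zero>\<^bsub>U\<^esub>} K V"
proof -
  interpret V: module K V by fact
  interpret U: module K U by fact
  show ?thesis
    using assms
    by (intro V.submoduleI) (auto simp: linear_mapD linear_map_zero linear_map_uminus)
qed

lemma submodule_lin_span:
  assumes "module K V" "S \<subseteq> carrier V"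
  shows "submodule (lin_span K V S) K V"
proof -
  interpret V: module K V by fact
  have "lin_span K V S \<subseteq> carrier V"
    using hull_minimal[of S "carrier V" "\<lambda>N. submodule N K V"] assms(2) V.carrier_is_submodule
    by simp
  moreover have "\<zero>\<^bsub>V\<^esub> \<in> N" if "submodule N K V" for N
    using subgroup.one_closed[OF submodule.axioms(1)[OF that]] by simp
  ultimately show ?thesis
    unfolding hull_def
    by (intro V.submoduleI InterI) (simp_all add: V.submoduleE(3-5))
qed

definition bilinear_map ::
  "('k, 'r) ring_scheme \<Rightarrow> ('k, 'v, 'm) module_scheme \<Rightarrow> ('k, 'w, 'n) module_scheme \<Rightarrow>
    ('k, 'u, 'l) module_scheme \<Rightarrow> ('v \<Rightarrow> 'w \<Rightarrow> 'u) \<Rightarrow> bool"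
  where "bilinear_map K V W U \<beta> \<longleftrightarrow>
    (\<forall>v\<in>carrier V. linear_map K W U (\<beta> v)) \<and>
    (\<forall>w\<in>carrier W. linear_map K V U (\<lambda>v. \<beta> v w))"

lemma bilinear_mapI:
  assumes "\<And>v. v \<in> carrier V \<Longrightarrow> linear_map K W U (\<beta> v)"
    and "\<And>w. w \<in> carrier W \<Longrightarrow> linear_map K V U (\<lambda>v. \<beta> v w)"
  shows "bilinear_map K V W U \<beta>"
  using assms by (simp add: bilinear_map_def)

lemma bilinear_mapD:
  assumes "bilinear_map K V W U \<beta>"
  shows bilinear_map_right: "v \<in> carrier V \<Longrightarrow> linear_map K W U (\<beta> v)"
    and bilinear_map_left: "w \<in> carrier W \<Longrightarrow> linear_map K V U (\<lambda>v. \<beta> v w)"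
  using assms by (simp_all add: bilinear_map_def)

lemma bilinear_map_closed:
  assumes "bilinear_map K V W U \<beta>" "v \<in> carrier V" "w \<in> carrier W"
  shows "\<beta> v w \<in> carrier U"
  using linear_map_closed[OF bilinear_map_right[OF assms(1,2)] assms(3)] .

lemma bilinear_map_compose:
  assumes "bilinear_map K V' W' U \<beta>" "linear_map K V V' f" "linear_map K W W' g"
  shows "bilinear_map K V W U (\<lambda>v w. \<beta> (f v) (g w))"
proof (rule bilinear_mapI)
  show "linear_map K W U (\<lambda>w. \<beta> (f v) (g w))" if "v \<in> carrier V" for v
    using linear_map_comp[OF assms(3) bilinear_map_right[OF assms(1)]]
      linear_map_closed[OF assms(2) that] by blast
  show "linear_map K V U (\<lambda>v. \<beta> (f v) (g w))" if "w \<in> carrier W" for w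
    using linear_map_comp[OF assms(2) bilinear_map_left[OF assms(1)]]
      linear_map_closed[OF assms(3) that] by blast
qed

lemma bilinear_map_flip: "bilinear_map K V W U \<beta> \<Longrightarrow> bilinear_map K W V U (\<lambda>w v. \<beta> v w)"
  by (simp add: bilinear_map_def)

lemma bilinear_map_zero:
  assumes "module K V" "module K W" "module K U" "bilinear_map K V W U \<beta>"
  shows "w \<in> carrier W \<Longrightarrow> \<beta> \<zero>\<^bsub>V\<^esub> w = \<zero>\<^bsub>U\<^esub>" "v \<in> carrier V \<Longrightarrow> \<beta> v \<zero>\<^bsub>W\<^esub> = \<zero>\<^bsub>U\<^esub>"
  by (rule linear_map_zero[OF assms(1,3) bilinear_map_left[OF assms(4)]], assumption)
    (rule linear_map_zero[OF assms(2,3) bilinear_map_right[OF assms(4)]], assumption)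

text \<open>
  With \<open>f = \<epsilon>\<close> this is the map \<open>\<epsilon> \<otimes> id\<close> of the counit axioms, after \<open>K \<otimes> W = W\<close>.
\<close>

lemma bilinear_map_functional_smult:
  assumes "module K W"
    and "\<And>x. x \<in> carrier V \<Longrightarrow> f x \<in> carrier K"
    and "\<And>x y. x \<in> carrier V \<Longrightarrow> y \<in> carrier V \<Longrightarrow> f (x \<oplus>\<^bsub>V\<^esub> y) = f x \<oplus>\<^bsub>K\<^esub> f y"
    and "\<And>k x. k \<in> carrier K \<Longrightarrow> x \<in> carrier V \<Longrightarrow> f (k \<odot>\<^bsub>V\<^esub> x) = k \<otimes>\<^bsub>K\<^esub> f x"
  shows "bilinear_map K V W W (\<lambda>x y. f x \<odot>\<^bsub>W\<^esub> y)"
proof -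
  interpret W: module K W by fact
  have "f x \<odot>\<^bsub>W\<^esub> (k \<odot>\<^bsub>W\<^esub> y) = k \<odot>\<^bsub>W\<^esub> (f x \<odot>\<^bsub>W\<^esub> y)"
    if "k \<in> carrier K" "x \<in> carrier V" "y \<in> carrier W" for k x y
    using that assms(2) by (simp add: W.smult_assoc1[symmetric] W.R.m_comm)
  then show ?thesis
    by (intro bilinear_mapI linear_mapI)
      (simp_all add: assms(2-4) W.smult_l_distr W.smult_r_distr W.smult_assoc1)
qed

text \<open>
  A surjection compatible with the operations transports the module axioms; this is how
  a quotient becomes a module.
\<close>

lemma module_surjective_image:
  fixes K :: "('k, 'r) ring_scheme" and V :: "('k, 'v, 'm) module_scheme"
    and Q :: "('k, 'q, 'n) module_scheme"
  assumes "module K V" and surj: "carrier Q = f ` carrier V" and zero: "\<zero>\<^bsub>Q\<^esub> = f \<zero>\<^bsub>V\<^esub>"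
    and add: "\<And>x y. x \<in> carrier V \<Longrightarrow> y \<in> carrier V \<Longrightarrow> f x \<oplus>\<^bsub>Q\<^esub> f y = f (x \<oplus>\<^bsub>V\<^esub> y)"
    and smult: "\<And>k x. k \<in> carrier K \<Longrightarrow> x \<in> carrier V \<Longrightarrow> k \<odot>\<^bsub>Q\<^esub> f x = f (k \<odot>\<^bsub>V\<^esub> x)"
  shows "module K Q"
proof -
  interpret V: module K V by fact
  show ?thesis
  proof (rule moduleI)
    show "cring K" by (rule V.R.is_cring)
    show "abelian_group Q"
    proof (rule abelian_groupI)
      fix x assume "x \<in> carrier Q"
      then obtain v where v: "v \<in> carrier V" "x = f v" using surj by auto
      have "f (\<ominus>\<^bsub>V\<^esub> v) \<oplus>\<^bsub>Q\<^esub> x = \<zero>\<^bsub>Q\<^esub>" using v by (simp add: add zero V.l_neg)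
      then show "\<exists>y\<in>carrier Q. y \<oplus>\<^bsub>Q\<^esub> x = \<zero>\<^bsub>Q\<^esub>" using v surj by auto
    qed (auto simp: surj zero add V.a_ac)
  qed (auto simp: surj add smult V.smult_l_distr V.smult_r_distr V.smult_assoc1)
qed


section \<open>Quotients\<close>

lemma quotient_mod_simps:
  "carrier (quotient_mod V N) = (\<lambda>v. N +>\<^bsub>V\<^esub> v) ` carrier V"
  "\<zero>\<^bsub>quotient_mod V N\<^esub> = N"
  "\<one>\<^bsub>quotient_mod V N\<^esub> = N +>\<^bsub>V\<^esub> \<one>\<^bsub>V\<^esub>"
  "monoid.mult (quotient_mod V N) = rcoset_mult V N"
  "add (quotient_mod V N) = set_add V"
  "smult (quotient_mod V N) = (\<lambda>k C. \<Union>x\<in>C. N +>\<^bsub>V\<^esub> (k \<odot>\<^bsub>V\<^esub> x))"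
  by (auto simp: quotient_mod_def FactRing_def ring.defs module.defs A_RCOSETS_def' a_r_coset_def')

context
  fixes K :: "('k, 'r) ring_scheme" and V :: "('k, 'v, 'm) module_scheme" and N :: "'v set"
  assumes V: "module K V" and N: "submodule N K V"
begin

interpretation V: module K V by (rule V)

interpretation N: abelian_subgroup N V
  by (rule abelian_subgroupI3)
    (simp_all add: additive_subgroup_def submodule.axioms(1)[OF N] V.abelian_group_axioms)

lemma quotient_mod_add:
  assumes "x \<in> carrier V" "y \<in> carrier V"
  shows "(N +>\<^bsub>V\<^esub> x) \<oplus>\<^bsub>quotient_mod V N\<^esub> (N +>\<^bsub>V\<^esub> y) = N +>\<^bsub>V\<^esub> (x \<oplus>\<^bsub>V\<^esub> y)"
  using assms by (simp add: quotient_mod_simps N.a_rcos_sum)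

text \<open>
  The scalar multiple of a coset is a union over all its elements \<open>y\<close>; each of them contributes the
  same coset, as \<open>k \<odot> N \<subseteq> N\<close>.
\<close>

lemma quotient_mod_smult:
  assumes "k \<in> carrier K" "x \<in> carrier V"
  shows "k \<odot>\<^bsub>quotient_mod V N\<^esub> (N +>\<^bsub>V\<^esub> x) = N +>\<^bsub>V\<^esub> (k \<odot>\<^bsub>V\<^esub> x)"
proof -
  have "N +>\<^bsub>V\<^esub> (k \<odot>\<^bsub>V\<^esub> y) = N +>\<^bsub>V\<^esub> (k \<odot>\<^bsub>V\<^esub> x)" if "y \<in> N +>\<^bsub>V\<^esub> x" for y
  proof -
    from that obtain n where n: "n \<in> N" "y = n \<oplus>\<^bsub>V\<^esub> x"
      by (auto simp: a_r_coset_def')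
    then have "k \<odot>\<^bsub>V\<^esub> y = k \<odot>\<^bsub>V\<^esub> n \<oplus>\<^bsub>V\<^esub> k \<odot>\<^bsub>V\<^esub> x"
      using assms N.a_subset by (auto simp: V.smult_r_distr)
    moreover have "k \<odot>\<^bsub>V\<^esub> n \<in> N"
      using assms n by (intro V.submoduleE(4)[OF N])
    ultimately have "k \<odot>\<^bsub>V\<^esub> y \<in> N +>\<^bsub>V\<^esub> (k \<odot>\<^bsub>V\<^esub> x)"
      by (auto simp: a_r_coset_def')
    then show ?thesis
      using assms N.a_repr_independence' by auto
  qed
  moreover have "x \<in> N +>\<^bsub>V\<^esub> x" using assms by (intro N.a_rcos_self)
  ultimately have "(\<Union>y\<in>N +>\<^bsub>V\<^esub> x. N +>\<^bsub>V\<^esub> (k \<odot>\<^bsub>V\<^esub> y)) = N +>\<^bsub>V\<^esub> (k \<odot>\<^bsub>V\<^esub> x)"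
    by blast
  then show ?thesis by (simp only: quotient_mod_simps(6))
qed

lemma module_quotient_mod: "module K (quotient_mod V N)"
proof (rule module_surjective_image[OF V])
  show "\<zero>\<^bsub>quotient_mod V N\<^esub> = N +>\<^bsub>V\<^esub> \<zero>\<^bsub>V\<^esub>"
    using N.a_subset by (simp add: quotient_mod_simps)
qed (simp_all add: quotient_mod_add quotient_mod_smult quotient_mod_simps(1))

lemma linear_map_quotient: "linear_map K V (quotient_mod V N) (\<lambda>v. N +>\<^bsub>V\<^esub> v)"
  by (rule linear_mapI) (simp_all add: quotient_mod_add quotient_mod_smult quotient_mod_simps(1))

lemma quotient_eqI:
  assumes "x \<in> carrier V" "y \<in> carrier V" "x \<ominus>\<^bsub>V\<^esub> y \<in> N"
  shows "N +>\<^bsub>V\<^esub> x = N +>\<^bsub>V\<^esub> y"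
proof -
  have "x \<in> N +>\<^bsub>V\<^esub> y"
    using assms N.a_rcos_module[of y x] by (simp add: a_minus_def)
  then show ?thesis
    using N.a_repr_independence' assms(2) by metis
qed

end


section \<open>Free modules\<close>

lemma free_module_simps:
  "carrier (free_module K S) = {p. (\<forall>x. p x \<in> carrier K) \<and> (\<forall>x. x \<notin> S \<longrightarrow> p x = \<zero>\<^bsub>K\<^esub>) \<and>
     finite {x. p x \<noteq> \<zero>\<^bsub>K\<^esub>}}"
  "\<zero>\<^bsub>free_module K S\<^esub> = (\<lambda>_. \<zero>\<^bsub>K\<^esub>)"
  "p \<oplus>\<^bsub>free_module K S\<^esub> q = (\<lambda>x. p x \<oplus>\<^bsub>K\<^esub> q x)"
  "k \<odot>\<^bsub>free_module K S\<^esub> p = (\<lambda>x. k \<otimes>\<^bsub>K\<^esub> p x)"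
  by (simp_all add: free_module_def)

text \<open>
  The linear extension of \<open>\<beta>\<close> from the basis vectors, as a sum over the support; \<open>tensor_lift\<close> applies
  this sum to every representative of a tensor.
\<close>

definition free_lift ::
  "('k, 'r) ring_scheme \<Rightarrow> ('k, 'u, 'l) module_scheme \<Rightarrow> ('x \<Rightarrow> 'u) \<Rightarrow> ('x \<Rightarrow> 'k) \<Rightarrow> 'u"
  where "free_lift K U \<beta> p = finsum U (\<lambda>x. p x \<odot>\<^bsub>U\<^esub> \<beta> x) {x. p x \<noteq> \<zero>\<^bsub>K\<^esub>}"

context
  fixes K :: "('k, 'r) ring_scheme"
  assumes K: "cring K"
begin

interpretation K: cring K by (rule K)

lemma module_free_module: "module K (free_module K S)"
proof (rule moduleI)
  have add_closed: "(\<lambda>x. p x \<oplus>\<^bsub>K\<^esub> q x) \<in> carrier (free_module K S)"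
    if "p \<in> carrier (free_module K S)" "q \<in> carrier (free_module K S)" for p q
  proof -
    have "finite {x. p x \<oplus>\<^bsub>K\<^esub> q x \<noteq> \<zero>\<^bsub>K\<^esub>}"
      by (rule finite_subset[of _ "{x. p x \<noteq> \<zero>\<^bsub>K\<^esub>} \<union> {x. q x \<noteq> \<zero>\<^bsub>K\<^esub>}"])
        (use that in \<open>auto simp: free_module_simps\<close>)
    then show ?thesis using that by (auto simp: free_module_simps)
  qed
  show "cring K" by (rule K)
  show "abelian_group (free_module K S)"
  proof (rule abelian_groupI)
    fix p assume p: "p \<in> carrier (free_module K S)"
    have "finite {x. \<ominus>\<^bsub>K\<^esub> p x \<noteq> \<zero>\<^bsub>K\<^esub>}"
      by (rule finite_subset[of _ "{x. p x \<noteq> \<zero>\<^bsub>K\<^esub>}"])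
        (use p in \<open>auto simp: free_module_simps\<close>)
    then have "(\<lambda>x. \<ominus>\<^bsub>K\<^esub> p x) \<in> carrier (free_module K S)"
      using p by (auto simp: free_module_simps)
    then show "\<exists>q\<in>carrier (free_module K S). q \<oplus>\<^bsub>free_module K S\<^esub> p = \<zero>\<^bsub>free_module K S\<^esub>"
      by (rule bexI[rotated]) (use p in \<open>simp add: free_module_simps K.l_neg\<close>)
  next
    show "p \<oplus>\<^bsub>free_module K S\<^esub> q \<in> carrier (free_module K S)"
      if "p \<in> carrier (free_module K S)" "q \<in> carrier (free_module K S)" for p q
      using add_closed[OF that] by (simp add: free_module_simps(3))
  qed (auto simp: free_module_simps K.a_ac)
  fix k p assume k: "k \<in> carrier K" and p: "p \<in> carrier (free_module K S)"
  have "finite {x. k \<otimes>\<^bsub>K\<^esub> p x \<noteq> \<zero>\<^bsub>K\<^esub>}"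
    by (rule finite_subset[of _ "{x. p x \<noteq> \<zero>\<^bsub>K\<^esub>}"])
      (use k p in \<open>auto simp: free_module_simps\<close>)
  then show "k \<odot>\<^bsub>free_module K S\<^esub> p \<in> carrier (free_module K S)"
    using k p by (auto simp: free_module_simps)
qed (auto simp: free_module_simps K.l_distr K.r_distr K.m_assoc)

lemma basis_vec_closed: "x \<in> S \<Longrightarrow> basis_vec K x \<in> carrier (free_module K S)"
  by (auto simp: free_module_simps basis_vec_def)

lemma free_module_carrierD:
  assumes "p \<in> carrier (free_module K S)"
  shows "p x \<in> carrier K" "x \<notin> S \<Longrightarrow> p x = \<zero>\<^bsub>K\<^esub>" "finite {x. p x \<noteq> \<zero>\<^bsub>K\<^esub>}"
    "{x. p x \<noteq> \<zero>\<^bsub>K\<^esub>} \<subseteq> S"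
  using assms by (auto simp: free_module_simps(1))

text \<open>
  The supports of two vectors, of their sum and of a multiple differ; enlarging the index set makes the
  sums comparable.
\<close>

lemma free_lift_superset:
  assumes "module K U" "\<beta> \<in> S \<rightarrow> carrier U" "p \<in> carrier (free_module K S)"
    and "finite A" "{x. p x \<noteq> \<zero>\<^bsub>K\<^esub>} \<subseteq> A" "A \<subseteq> S"
  shows "free_lift K U \<beta> p = finsum U (\<lambda>x. p x \<odot>\<^bsub>U\<^esub> \<beta> x) A"
proof -
  interpret U: module K U by fact
  show ?thesis
    unfolding free_lift_def
  proof (rule U.add.finprod_mono_neutral_cong_left)
    show "(\<lambda>x. p x \<odot>\<^bsub>U\<^esub> \<beta> x) \<in> A \<rightarrow> carrier U"
      using assms(2,6) free_module_carrierD(1)[OF assms(3)] by blast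
    show "p x \<odot>\<^bsub>U\<^esub> \<beta> x = \<zero>\<^bsub>U\<^esub>" if "x \<in> A - {x. p x \<noteq> \<zero>\<^bsub>K\<^esub>}" for x
    proof -
      have "p x = \<zero>\<^bsub>K\<^esub>" "\<beta> x \<in> carrier U" using that assms(2,6) by auto
      then show ?thesis by simp
    qed
  qed (use assms(4,5) in simp_all)
qed

lemma linear_map_free_lift:
  assumes "module K U" "\<beta> \<in> S \<rightarrow> carrier U"
  shows "linear_map K (free_module K S) U (free_lift K U \<beta>)"
proof (rule linear_mapI)
  interpret U: module K U by fact
  let ?F = "free_module K S"
  interpret F: module K ?F by (rule module_free_module)
  note supp = free_module_carrierD(3,4)
  have terms: "(\<lambda>x. p x \<odot>\<^bsub>U\<^esub> \<beta> x) \<in> A \<rightarrow> carrier U" if "p \<in> carrier ?F" "A \<subseteq> S" for p A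
    using that(2) assms(2) free_module_carrierD(1)[OF that(1)] by blast
  note sum = free_lift_superset[OF assms]
  fix p assume p: "p \<in> carrier ?F"
  show "free_lift K U \<beta> p \<in> carrier U"
    unfolding free_lift_def by (rule U.finsum_closed) (use terms[OF p] supp[OF p] in auto)
  show "free_lift K U \<beta> (k \<odot>\<^bsub>?F\<^esub> p) = k \<odot>\<^bsub>U\<^esub> free_lift K U \<beta> p" if k: "k \<in> carrier K" for k
  proof -
    let ?A = "{x. p x \<noteq> \<zero>\<^bsub>K\<^esub>}"
    have "free_lift K U \<beta> (k \<odot>\<^bsub>?F\<^esub> p) = finsum U (\<lambda>x. (k \<odot>\<^bsub>?F\<^esub> p) x \<odot>\<^bsub>U\<^esub> \<beta> x) ?A"
    proof (rule sum)
      show "{x. (k \<odot>\<^bsub>?F\<^esub> p) x \<noteq> \<zero>\<^bsub>K\<^esub>} \<subseteq> ?A"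
        using k by (auto simp: free_module_simps(4))
    qed (use supp[OF p] k p in simp_all)
    also have "\<dots> = finsum U (\<lambda>x. k \<odot>\<^bsub>U\<^esub> (p x \<odot>\<^bsub>U\<^esub> \<beta> x)) ?A"
    proof (rule U.finsum_cong')
      show "(\<lambda>x. k \<odot>\<^bsub>U\<^esub> (p x \<odot>\<^bsub>U\<^esub> \<beta> x)) \<in> ?A \<rightarrow> carrier U"
        using terms[OF p supp(2)[OF p]] k by blast
      show "(k \<odot>\<^bsub>?F\<^esub> p) x \<odot>\<^bsub>U\<^esub> \<beta> x = k \<odot>\<^bsub>U\<^esub> (p x \<odot>\<^bsub>U\<^esub> \<beta> x)" if "x \<in> ?A" for x
      proof -
        have "\<beta> x \<in> carrier U" using that supp(2)[OF p] assms(2) by blast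
        then show ?thesis
          using k free_module_carrierD(1)[OF p] by (simp add: free_module_simps(4) U.smult_assoc1)
      qed
    qed simp
    also have "\<dots> = k \<odot>\<^bsub>U\<^esub> free_lift K U \<beta> p"
      unfolding free_lift_def
      by (rule U.finsum_smult_ldistr[symmetric]) (use terms[OF p] supp[OF p] k in auto)
    finally show ?thesis .
  qed
  fix q assume q: "q \<in> carrier ?F"
  let ?A = "{x. p x \<noteq> \<zero>\<^bsub>K\<^esub>} \<union> {x. q x \<noteq> \<zero>\<^bsub>K\<^esub>}"
  have A: "finite ?A" "?A \<subseteq> S" using supp[OF p] supp[OF q] by auto
  have "free_lift K U \<beta> (p \<oplus>\<^bsub>?F\<^esub> q) = finsum U (\<lambda>x. (p \<oplus>\<^bsub>?F\<^esub> q) x \<odot>\<^bsub>U\<^esub> \<beta> x) ?A"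
  proof (rule sum)
    show "{x. (p \<oplus>\<^bsub>?F\<^esub> q) x \<noteq> \<zero>\<^bsub>K\<^esub>} \<subseteq> ?A"
      by (auto simp: free_module_simps(3))
  qed (use A p q in simp_all)
  also have "\<dots> = finsum U (\<lambda>x. p x \<odot>\<^bsub>U\<^esub> \<beta> x \<oplus>\<^bsub>U\<^esub> q x \<odot>\<^bsub>U\<^esub> \<beta> x) ?A"
  proof (rule U.finsum_cong')
    show "(\<lambda>x. p x \<odot>\<^bsub>U\<^esub> \<beta> x \<oplus>\<^bsub>U\<^esub> q x \<odot>\<^bsub>U\<^esub> \<beta> x) \<in> ?A \<rightarrow> carrier U"
      using terms[OF p A(2)] terms[OF q A(2)] by blast
    show "(p \<oplus>\<^bsub>?F\<^esub> q) x \<odot>\<^bsub>U\<^esub> \<beta> x = p x \<odot>\<^bsub>U\<^esub> \<beta> x \<oplus>\<^bsub>U\<^esub> q x \<odot>\<^bsub>U\<^esub> \<beta> x" if "x \<in> ?A" for x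
    proof -
      have "\<beta> x \<in> carrier U" using that A(2) assms(2) by blast
      then show ?thesis
        using free_module_carrierD(1)[OF p] free_module_carrierD(1)[OF q]
        by (simp add: free_module_simps(3) U.smult_l_distr)
    qed
  qed simp
  also have "\<dots> = finsum U (\<lambda>x. p x \<odot>\<^bsub>U\<^esub> \<beta> x) ?A \<oplus>\<^bsub>U\<^esub> finsum U (\<lambda>x. q x \<odot>\<^bsub>U\<^esub> \<beta> x) ?A"
    using terms p q A by (intro U.finsum_addf)
  also have "\<dots> = free_lift K U \<beta> p \<oplus>\<^bsub>U\<^esub> free_lift K U \<beta> q"
    using sum[of p ?A] sum[of q ?A] A p q by simp
  finally show "free_lift K U \<beta> (p \<oplus>\<^bsub>?F\<^esub> q) = free_lift K U \<beta> p \<oplus>\<^bsub>U\<^esub> free_lift K U \<beta> q" .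
qed

lemma free_lift_basis_vec:
  assumes "module K U" "\<beta> \<in> S \<rightarrow> carrier U" "x \<in> S"
  shows "free_lift K U \<beta> (basis_vec K x) = \<beta> x"
proof -
  interpret U: module K U by fact
  have "free_lift K U \<beta> (basis_vec K x) = finsum U (\<lambda>y. basis_vec K x y \<odot>\<^bsub>U\<^esub> \<beta> y) {x}"
    using assms by (intro free_lift_superset basis_vec_closed) (auto simp: basis_vec_def)
  also have "\<dots> = \<beta> x"
    using funcset_mem[OF assms(2,3)] by (subst U.finsum_insert) (auto simp: basis_vec_def)
  finally show ?thesis .
qed

text \<open>
  Every vector is a finite combination of basis vectors: induction on a finite set that contains
  the support, splitting off one coordinate at a time.
\<close>

lemma free_module_induct:
  assumes "submodule N K (free_module K S)" "\<And>x. x \<in> S \<Longrightarrow> basis_vec K x \<in> N"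
    and "p \<in> carrier (free_module K S)"
  shows "p \<in> N"
proof -
  interpret F: module K "free_module K S" by (rule module_free_module)
  note N = F.submoduleE[OF assms(1)]
  have zero: "\<zero>\<^bsub>free_module K S\<^esub> \<in> N"
    using subgroup.one_closed[OF submodule.axioms(1)[OF assms(1)]] by simp
  have "q \<in> N" if "finite A" "q \<in> carrier (free_module K S)" "{x. q x \<noteq> \<zero>\<^bsub>K\<^esub>} \<subseteq> A" for q A
    using that
  proof (induction A arbitrary: q rule: finite_induct)
    case empty
    then have "q = \<zero>\<^bsub>free_module K S\<^esub>" by (auto simp: free_module_simps)
    then show ?case using zero by simp
  next
    case (insert a A)
    have K: "q x \<in> carrier K" for x using insert.prems by (auto simp: free_module_simps)
    show ?case
    proof (cases "a \<in> S")
      case False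
      then have "{x. q x \<noteq> \<zero>\<^bsub>K\<^esub>} \<subseteq> A" using insert.prems by (auto simp: free_module_simps)
      then show ?thesis using insert by blast
    next
      case True
      let ?r = "q(a := \<zero>\<^bsub>K\<^esub>)"
      have "finite {x. ?r x \<noteq> \<zero>\<^bsub>K\<^esub>}"
        by (rule finite_subset[of _ "{x. q x \<noteq> \<zero>\<^bsub>K\<^esub>}"])
          (use insert.prems in \<open>auto simp: free_module_simps\<close>)
      then have "?r \<in> carrier (free_module K S)"
        using insert.prems by (auto simp: free_module_simps)
      moreover have "{x. ?r x \<noteq> \<zero>\<^bsub>K\<^esub>} \<subseteq> A" using insert.prems by auto
      ultimately have "?r \<in> N" by (rule insert.IH)
      moreover have "q a \<odot>\<^bsub>free_module K S\<^esub> basis_vec K a \<in> N"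
        using K assms(2) True by (intro N(4)) auto
      ultimately have "?r \<oplus>\<^bsub>free_module K S\<^esub> (q a \<odot>\<^bsub>free_module K S\<^esub> basis_vec K a) \<in> N"
        by (intro N(5))
      also have "?r \<oplus>\<^bsub>free_module K S\<^esub> (q a \<odot>\<^bsub>free_module K S\<^esub> basis_vec K a) = q"
        using K by (auto simp: free_module_simps basis_vec_def)
      finally show ?thesis .
    qed
  qed
  from this[of "{x. p x \<noteq> \<zero>\<^bsub>K\<^esub>}" p] assms(3) show ?thesis
    by (simp add: free_module_simps)
qed

end


section \<open>Tensor products\<close>

context
  fixes K :: "('k, 'r) ring_scheme" and V :: "('k, 'v, 'm) module_scheme"
    and W :: "('k, 'w, 'n) module_scheme"
  assumes V: "module K V" and W: "module K W"
begin

interpretation V: module K V by (rule V)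
interpretation W: module K W by (rule W)

private lemmas K = V.R.is_cring

interpretation F: module K "free_pairs K V W" by (rule module_free_module[OF K])

lemma basis_vec_pair_closed:
  "v \<in> carrier V \<Longrightarrow> w \<in> carrier W \<Longrightarrow> basis_vec K (v, w) \<in> carrier (free_pairs K V W)"
  by (simp add: basis_vec_closed[OF K])

lemma bilinear_rels_closed: "bilinear_rels K V W \<subseteq> carrier (free_pairs K V W)"
  unfolding bilinear_rels_def Let_def
  by (auto intro!: F.minus_closed F.a_closed F.smult_closed basis_vec_pair_closed)

lemma submodule_tensor_rel_space:
  "submodule (tensor_rel_space K V W) K (free_pairs K V W)"
  unfolding tensor_rel_space_def
  by (intro submodule_lin_span F.module_axioms bilinear_rels_closed)

lemma bilinear_rels_subset: "bilinear_rels K V W \<subseteq> tensor_rel_space K V W"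
  unfolding tensor_rel_space_def by (rule hull_subset)

lemma module_tensor: "module K (tensor K V W)"
  unfolding tensor_def by (rule module_quotient_mod[OF F.module_axioms submodule_tensor_rel_space])

lemma linear_map_tensor_coset:
  "linear_map K (free_pairs K V W) (tensor K V W)
    (\<lambda>p. tensor_rel_space K V W +>\<^bsub>free_pairs K V W\<^esub> p)"
  unfolding tensor_def by (rule linear_map_quotient[OF F.module_axioms submodule_tensor_rel_space])

lemma tensor_relation:
  assumes "p \<ominus>\<^bsub>free_pairs K V W\<^esub> q \<in> bilinear_rels K V W"
    and "p \<in> carrier (free_pairs K V W)" "q \<in> carrier (free_pairs K V W)"
  shows "tensor_rel_space K V W +>\<^bsub>free_pairs K V W\<^esub> p =
    tensor_rel_space K V W +>\<^bsub>free_pairs K V W\<^esub> q"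
  using assms bilinear_rels_subset
  by (intro quotient_eqI[OF F.module_axioms submodule_tensor_rel_space]) auto

lemma bilinear_map_pure_tensor: "bilinear_map K V W (tensor K V W) (pure_tensor K V W)"
proof -
  note coset = linear_map_tensor_coset
  note closed = basis_vec_pair_closed
  have memb: "pure_tensor K V W v w \<in> carrier (tensor K V W)"
    if "v \<in> carrier V" "w \<in> carrier W" for v w
    unfolding pure_tensor_def using that by (intro linear_map_closed[OF coset] closed)
  have add_left: "pure_tensor K V W (v \<oplus>\<^bsub>V\<^esub> v') w =
      pure_tensor K V W v w \<oplus>\<^bsub>tensor K V W\<^esub> pure_tensor K V W v' w"
    if "v \<in> carrier V" "v' \<in> carrier V" "w \<in> carrier W" for v v' w
    unfolding pure_tensor_def using that
    by (subst linear_map_add[OF coset, symmetric], simp_all add: closed)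
      (rule tensor_relation, auto simp: bilinear_rels_def Let_def closed)
  have add_right: "pure_tensor K V W v (w \<oplus>\<^bsub>W\<^esub> w') =
      pure_tensor K V W v w \<oplus>\<^bsub>tensor K V W\<^esub> pure_tensor K V W v w'"
    if "v \<in> carrier V" "w \<in> carrier W" "w' \<in> carrier W" for v w w'
    unfolding pure_tensor_def using that
    by (subst linear_map_add[OF coset, symmetric], simp_all add: closed)
      (rule tensor_relation, auto simp: bilinear_rels_def Let_def closed)
  have smult_left: "pure_tensor K V W (k \<odot>\<^bsub>V\<^esub> v) w = k \<odot>\<^bsub>tensor K V W\<^esub> pure_tensor K V W v w"
    if "k \<in> carrier K" "v \<in> carrier V" "w \<in> carrier W" for k v w
    unfolding pure_tensor_def using that
    by (subst linear_map_smult[OF coset, symmetric], simp_all add: closed)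
      (rule tensor_relation, auto simp: bilinear_rels_def Let_def closed)
  have smult_right: "pure_tensor K V W v (k \<odot>\<^bsub>W\<^esub> w) = k \<odot>\<^bsub>tensor K V W\<^esub> pure_tensor K V W v w"
    if "k \<in> carrier K" "v \<in> carrier V" "w \<in> carrier W" for k v w
    unfolding pure_tensor_def using that
    by (subst linear_map_smult[OF coset, symmetric], simp_all add: closed)
      (rule tensor_relation, auto simp: bilinear_rels_def Let_def closed)
  show ?thesis
    by (intro bilinear_mapI linear_mapI memb add_left add_right smult_left smult_right)
qed

text \<open>
  Bilinearity of \<open>\<beta>\<close> says exactly that its linear extension kills the four kinds of generating
  relations, and a kernel is a subspace. So the value at a representative depends on its coset only, and
  the description in \<open>tensor_lift\<close> is well defined.
\<close>

lemma free_lift_vanishes_on_relations: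
  assumes "module K U" "bilinear_map K V W U \<beta>" "p \<in> tensor_rel_space K V W"
  shows "free_lift K U (\<lambda>x. \<beta> (fst x) (snd x)) p = \<zero>\<^bsub>U\<^esub>"
proof -
  interpret U: module K U by fact
  let ?F = "free_pairs K V W" and ?L = "free_lift K U (\<lambda>x. \<beta> (fst x) (snd x))"
  have \<beta>: "(\<lambda>x. \<beta> (fst x) (snd x)) \<in> carrier V \<times> carrier W \<rightarrow> carrier U"
    using bilinear_map_closed[OF assms(2)] by auto
  note L = linear_map_free_lift[OF K assms(1) \<beta>]
  note L_basis = free_lift_basis_vec[OF K assms(1) \<beta>]
  note L_minus = linear_map_minus[OF F.module_axioms assms(1) L]
  have eq: "?L (x \<ominus>\<^bsub>?F\<^esub> y) = \<zero>\<^bsub>U\<^esub>"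
    if "x \<in> carrier ?F" "y \<in> carrier ?F" "?L x = ?L y" for x y
    using that L_minus[of x y] linear_map_closed[OF L, of y] by (simp add: U.r_neg a_minus_def)
  note lin = linear_mapD(2,3)[OF bilinear_map_left[OF assms(2)]]
    linear_mapD(2,3)[OF bilinear_map_right[OF assms(2)]]
  have "?L p = \<zero>\<^bsub>U\<^esub>" if "p \<in> bilinear_rels K V W" for p
    using that unfolding bilinear_rels_def Let_def
    by (elim UnE CollectE exE conjE; hypsubst; intro eq)
      (simp_all add: basis_vec_pair_closed linear_map_add[OF L] linear_map_smult[OF L] L_basis lin)
  then have "tensor_rel_space K V W \<subseteq> {p \<in> carrier ?F. ?L p = \<zero>\<^bsub>U\<^esub>}"
    unfolding tensor_rel_space_def using bilinear_rels_closed
    by (intro hull_minimal submodule_kernel F.module_axioms assms(1) L) auto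
  then show ?thesis using assms(3) by blast
qed

lemma tensor_lift_coset:
  assumes "module K U" "bilinear_map K V W U \<beta>" "p \<in> carrier (free_pairs K V W)"
  shows "tensor_lift K U \<beta> (tensor_rel_space K V W +>\<^bsub>free_pairs K V W\<^esub> p) =
    free_lift K U (\<lambda>x. \<beta> (fst x) (snd x)) p"
proof -
  interpret U: module K U by fact
  interpret R: submodule "tensor_rel_space K V W" K "free_pairs K V W"
    by (rule submodule_tensor_rel_space)
  let ?F = "free_pairs K V W" and ?L = "free_lift K U (\<lambda>x. \<beta> (fst x) (snd x))"
  let ?t = "tensor_rel_space K V W +>\<^bsub>?F\<^esub> p"
  have \<beta>: "(\<lambda>x. \<beta> (fst x) (snd x)) \<in> carrier V \<times> carrier W \<rightarrow> carrier U"
    using bilinear_map_closed[OF assms(2)] by auto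
  note L = linear_map_free_lift[OF K assms(1) \<beta>]
  have const: "?L q = ?L p" if "q \<in> ?t" for q
  proof -
    from that obtain n where n: "n \<in> tensor_rel_space K V W" "q = n \<oplus>\<^bsub>?F\<^esub> p"
      by (auto simp: a_r_coset_def')
    moreover have "n \<in> carrier ?F" using n R.subset by auto
    ultimately show ?thesis
      using free_lift_vanishes_on_relations[OF assms(1,2)] assms(3)
      by (simp add: linear_mapD[OF L])
  qed
  have "\<zero>\<^bsub>?F\<^esub> \<oplus>\<^bsub>?F\<^esub> p \<in> ?t"
    unfolding a_r_coset_def' using R.one_closed by auto
  then have p: "p \<in> ?t" using assms(3) by simp
  have "(THE u. \<forall>q\<in>?t. u = ?L q) = ?L p"
  proof (rule the_equality)
    show "\<forall>q\<in>?t. ?L p = ?L q" by (intro ballI sym[OF const])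
    show "u = ?L p" if "\<forall>q\<in>?t. u = ?L q" for u by (rule bspec[OF that p])
  qed
  then show ?thesis by (simp add: tensor_lift_def free_lift_def)
qed

lemma linear_map_tensor_lift:
  assumes "module K U" "bilinear_map K V W U \<beta>"
  shows "linear_map K (tensor K V W) U (tensor_lift K U \<beta>)"
proof -
  let ?q = "\<lambda>p. tensor_rel_space K V W +>\<^bsub>free_pairs K V W\<^esub> p"
  let ?L = "free_lift K U (\<lambda>x. \<beta> (fst x) (snd x))"
  have \<beta>: "(\<lambda>x. \<beta> (fst x) (snd x)) \<in> carrier V \<times> carrier W \<rightarrow> carrier U"
    using bilinear_map_closed[OF assms(2)] by auto
  note L = linear_map_free_lift[OF K assms(1) \<beta>]
  note lift = tensor_lift_coset[OF assms]
  note q = linear_map_tensor_coset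
  have carr: "carrier (tensor K V W) = ?q ` carrier (free_pairs K V W)"
    by (simp add: tensor_def quotient_mod_simps)
  show ?thesis
    by (rule linear_mapI)
      (auto simp: carr lift linear_mapD[OF L] linear_mapD(2,3)[OF q, symmetric])
qed

lemma tensor_lift_pure:
  assumes "module K U" "bilinear_map K V W U \<beta>" "v \<in> carrier V" "w \<in> carrier W"
  shows "tensor_lift K U \<beta> (pure_tensor K V W v w) = \<beta> v w"
proof -
  have \<beta>: "(\<lambda>x. \<beta> (fst x) (snd x)) \<in> carrier V \<times> carrier W \<rightarrow> carrier U"
    using bilinear_map_closed[OF assms(2)] by auto
  show ?thesis
    using assms(3,4) free_lift_basis_vec[OF K assms(1) \<beta>, of "(v, w)"]
    unfolding pure_tensor_def
    by (simp add: tensor_lift_coset[OF assms(1,2)] basis_vec_pair_closed)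
qed

text \<open>
  The uniqueness half of the universal property: the set where the two maps agree pulls back to a
  subspace of the free module that contains all basis vectors.
\<close>

lemma tensor_eqI:
  assumes "module K U" "linear_map K (tensor K V W) U f" "linear_map K (tensor K V W) U g"
    and pure: "\<And>v w. v \<in> carrier V \<Longrightarrow> w \<in> carrier W \<Longrightarrow>
      f (pure_tensor K V W v w) = g (pure_tensor K V W v w)"
    and "t \<in> carrier (tensor K V W)"
  shows "f t = g t"
proof -
  let ?q = "\<lambda>p. tensor_rel_space K V W +>\<^bsub>free_pairs K V W\<^esub> p"
  have "t \<in> ?q ` carrier (free_pairs K V W)"
    using assms(5) by (simp only: tensor_def quotient_mod_simps(1))
  then obtain p where p: "t = ?q p" "p \<in> carrier (free_pairs K V W)" by (rule imageE)
  note lin = linear_map_comp[OF linear_map_tensor_coset assms(2)]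
    linear_map_comp[OF linear_map_tensor_coset assms(3)]
  have "p \<in> {p \<in> carrier (free_pairs K V W). f (?q p) = g (?q p)}"
  proof (rule free_module_induct[OF K submodule_equalizer[OF F.module_axioms assms(1) lin] _ p(2)])
    fix x assume "x \<in> carrier V \<times> carrier W"
    then obtain v w where x: "x = (v, w)" "v \<in> carrier V" "w \<in> carrier W" by (rule SigmaE)
    show "basis_vec K x \<in> {p \<in> carrier (free_pairs K V W). f (?q p) = g (?q p)}"
      using pure[OF x(2,3)] basis_vec_pair_closed[OF x(2,3)] by (simp add: pure_tensor_def x(1))
  qed
  then show ?thesis using p(1) by simp
qed

end


section \<open>Maps between tensor products\<close>

text \<open>
  A family of bilinear maps that depends linearly on a parameter \<open>x\<close> lifts to maps that depend linearly
  on \<open>x\<close>: both sides of additivity in \<open>x\<close> are linear in the tensor, so pure tensors decide. The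
  associator and the multiplication of \<open>A \<otimes> C\<close> are iterated lifts, and this makes the outer lift legitimate.
\<close>

lemma bilinear_map_tensor_lift:
  assumes V: "module K V" and W: "module K W" and U: "module K U"
    and bil: "\<And>x. x \<in> carrier X \<Longrightarrow> bilinear_map K V W U (\<gamma> x)"
    and lin: "\<And>v w. v \<in> carrier V \<Longrightarrow> w \<in> carrier W \<Longrightarrow> linear_map K X U (\<lambda>x. \<gamma> x v w)"
    and X: "module K X"
  shows "bilinear_map K X (tensor K V W) U (\<lambda>x. tensor_lift K U (\<gamma> x))"
proof (rule bilinear_mapI)
  interpret X: module K X by fact
  note lift = linear_map_tensor_lift[OF V W U bil]
  note lift_pure = tensor_lift_pure[OF V W U bil]
  show "linear_map K (tensor K V W) U (tensor_lift K U (\<gamma> x))" if "x \<in> carrier X" for x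
    using that by (rule lift)
  show "linear_map K X U (\<lambda>x. tensor_lift K U (\<gamma> x) t)" if t: "t \<in> carrier (tensor K V W)" for t
  proof (rule linear_mapI)
    show "tensor_lift K U (\<gamma> x) t \<in> carrier U" if "x \<in> carrier X" for x
      using lift[OF that] t by (rule linear_map_closed)
    show "tensor_lift K U (\<gamma> (x \<oplus>\<^bsub>X\<^esub> y)) t = tensor_lift K U (\<gamma> x) t \<oplus>\<^bsub>U\<^esub> tensor_lift K U (\<gamma> y) t"
      if "x \<in> carrier X" "y \<in> carrier X" for x y
      by (rule tensor_eqI[OF V W U lift[OF X.a_closed[OF that]]
            linear_map_pointwise_add[OF U lift[OF that(1)] lift[OF that(2)]] _ t])
        (use that in \<open>simp add: lift_pure linear_map_add[OF lin]\<close>)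
    show "tensor_lift K U (\<gamma> (k \<odot>\<^bsub>X\<^esub> x)) t = k \<odot>\<^bsub>U\<^esub> tensor_lift K U (\<gamma> x) t"
      if "k \<in> carrier K" "x \<in> carrier X" for k x
      by (rule tensor_eqI[OF V W U lift[OF X.smult_closed[OF that]]
            linear_map_pointwise_smult[OF U lift[OF that(2)] that(1)] _ t])
        (use that in \<open>simp add: lift_pure linear_map_smult[OF lin]\<close>)
  qed
qed

context
  fixes K :: "('k, 'r) ring_scheme" and V :: "('k, 'v, 'm) module_scheme"
    and W :: "('k, 'w, 'n) module_scheme" and V' :: "('k, 'v', 'm') module_scheme"
    and W' :: "('k, 'w', 'n') module_scheme" and f :: "'v \<Rightarrow> 'v'" and g :: "'w \<Rightarrow> 'w'"
  assumes VW: "module K V" "module K W" and VW': "module K V'" "module K W'"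
    and fg: "linear_map K V V' f" "linear_map K W W' g"
begin

lemma linear_map_tensor_map:
  "linear_map K (tensor K V W) (tensor K V' W') (tensor_map K V' W' f g)"
  unfolding tensor_map_def
  by (intro linear_map_tensor_lift VW module_tensor VW'
      bilinear_map_compose[OF bilinear_map_pure_tensor[OF VW'] fg])

lemma tensor_map_pure:
  assumes "v \<in> carrier V" "w \<in> carrier W"
  shows "tensor_map K V' W' f g (pure_tensor K V W v w) = pure_tensor K V' W' (f v) (g w)"
  unfolding tensor_map_def
  by (intro tensor_lift_pure VW module_tensor VW'
      bilinear_map_compose[OF bilinear_map_pure_tensor[OF VW'] fg] assms)

end

context
  fixes K :: "('k, 'r) ring_scheme" and U :: "('k, 'u, 'l) module_scheme"
    and V :: "('k, 'v, 'm) module_scheme" and W :: "('k, 'w, 'n) module_scheme"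
  assumes U: "module K U" and V: "module K V" and W: "module K W"
begin

lemma bilinear_map_tensor_assoc_inner:
  assumes "w \<in> carrier W"
  shows "bilinear_map K U V (tensor K U (tensor K V W))
    (\<lambda>u v. pure_tensor K U (tensor K V W) u (pure_tensor K V W v w))"
  by (rule bilinear_map_compose[OF bilinear_map_pure_tensor[OF U module_tensor[OF V W]]
        linear_map_id bilinear_map_left[OF bilinear_map_pure_tensor[OF V W] assms]])

lemma bilinear_map_tensor_assoc:
  "bilinear_map K (tensor K U V) W (tensor K U (tensor K V W))
    (\<lambda>s w. tensor_lift K (tensor K U (tensor K V W))
      (\<lambda>u v. pure_tensor K U (tensor K V W) u (pure_tensor K V W v w)) s)"
proof (rule bilinear_map_flip, rule bilinear_map_tensor_lift)
  show "linear_map K W (tensor K U (tensor K V W))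
      (\<lambda>w. pure_tensor K U (tensor K V W) u (pure_tensor K V W v w))"
    if "u \<in> carrier U" "v \<in> carrier V" for u v
    using linear_map_comp[OF bilinear_map_right[OF bilinear_map_pure_tensor[OF V W] that(2)]
        bilinear_map_right[OF bilinear_map_pure_tensor[OF U module_tensor[OF V W]] that(1)]] .
qed (intro U V W module_tensor bilinear_map_tensor_assoc_inner | assumption)+

lemma linear_map_tensor_assoc:
  "linear_map K (tensor K (tensor K U V) W) (tensor K U (tensor K V W)) (tensor_assoc K U V W)"
  unfolding tensor_assoc_def Let_def
  by (intro linear_map_tensor_lift bilinear_map_tensor_assoc module_tensor U V W)

lemma tensor_assoc_pure:
  assumes "u \<in> carrier U" "v \<in> carrier V" "w \<in> carrier W"
  shows "tensor_assoc K U V W (pure_tensor K (tensor K U V) W (pure_tensor K U V u v) w) =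
    pure_tensor K U (tensor K V W) u (pure_tensor K V W v w)"
  unfolding tensor_assoc_def Let_def
  using assms bilinear_map_closed[OF bilinear_map_pure_tensor[OF U V] assms(1,2)]
  by (simp add: tensor_lift_pure[OF module_tensor[OF U V] W module_tensor[OF U module_tensor[OF V W]]
        bilinear_map_tensor_assoc]
      tensor_lift_pure[OF U V module_tensor[OF U module_tensor[OF V W]]
        bilinear_map_tensor_assoc_inner])

text \<open>
  For a fixed last factor both maps are linear on \<open>U \<otimes> V\<close>, so uniqueness of lifts applies twice.
\<close>

lemma tensor3_eqI:
  assumes Z: "module K Z"
    and f: "linear_map K (tensor K (tensor K U V) W) Z f"
    and g: "linear_map K (tensor K (tensor K U V) W) Z g"
    and pure: "\<And>u v w. u \<in> carrier U \<Longrightarrow> v \<in> carrier V \<Longrightarrow> w \<in> carrier W \<Longrightarrow>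
      f (pure_tensor K (tensor K U V) W (pure_tensor K U V u v) w) =
      g (pure_tensor K (tensor K U V) W (pure_tensor K U V u v) w)"
    and t: "t \<in> carrier (tensor K (tensor K U V) W)"
  shows "f t = g t"
proof (rule tensor_eqI[OF module_tensor[OF U V] W Z f g _ t])
  fix s w assume s: "s \<in> carrier (tensor K U V)" and w: "w \<in> carrier W"
  note p = bilinear_map_left[OF bilinear_map_pure_tensor[OF module_tensor[OF U V] W] w]
  show "f (pure_tensor K (tensor K U V) W s w) = g (pure_tensor K (tensor K U V) W s w)"
    using tensor_eqI[OF U V Z linear_map_comp[OF p f] linear_map_comp[OF p g] pure s] w by blast
qed

end

text \<open>
  Used to carry coassociativity from \<open>A\<close> to a quotient: on threefold pure tensors both sides are \<open>f u \<otimes> (g v \<otimes> h w)\<close>.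
\<close>

lemma tensor_assoc_natural:
  assumes UVW: "module K U" "module K V" "module K W"
    and UVW': "module K U'" "module K V'" "module K W'"
    and f: "linear_map K U U' f" and g: "linear_map K V V' g" and h: "linear_map K W W' h"
    and t: "t \<in> carrier (tensor K (tensor K U V) W)"
  shows "tensor_assoc K U' V' W'
      (tensor_map K (tensor K U' V') W' (tensor_map K U' V' f g) h t) =
    tensor_map K U' (tensor K V' W') f (tensor_map K V' W' g h) (tensor_assoc K U V W t)"
proof (rule tensor3_eqI[OF UVW _ _ _ _ t])
  note modules = UVW UVW' module_tensor
  note maps = linear_map_tensor_map linear_map_tensor_assoc f g h
  show "module K (tensor K U' (tensor K V' W'))"
    by (intro modules)
  show "linear_map K (tensor K (tensor K U V) W) (tensor K U' (tensor K V' W'))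
      (\<lambda>t. tensor_assoc K U' V' W'
        (tensor_map K (tensor K U' V') W' (tensor_map K U' V' f g) h t))"
    by (rule linear_map_comp[of K _ "tensor K (tensor K U' V') W'"]) (intro maps modules)+
  show "linear_map K (tensor K (tensor K U V) W) (tensor K U' (tensor K V' W'))
      (\<lambda>t. tensor_map K U' (tensor K V' W') f (tensor_map K V' W' g h) (tensor_assoc K U V W t))"
    by (rule linear_map_comp[of K _ "tensor K U (tensor K V W)"]) (intro maps modules)+
  fix u v w assume uvw: "u \<in> carrier U" "v \<in> carrier V" "w \<in> carrier W"
  note uvw' = linear_map_closed[OF f uvw(1)] linear_map_closed[OF g uvw(2)]
    linear_map_closed[OF h uvw(3)]
  note pure_closed = bilinear_map_closed[OF bilinear_map_pure_tensor]
  have "tensor_map K (tensor K U' V') W' (tensor_map K U' V' f g) h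
      (pure_tensor K (tensor K U V) W (pure_tensor K U V u v) w) =
    pure_tensor K (tensor K U' V') W' (pure_tensor K U' V' (f u) (g v)) (h w)"
    using uvw by (simp add: tensor_map_pure[where V = "tensor K U V"] tensor_map_pure[where V = U]
        modules maps pure_closed)
  moreover have "tensor_map K U' (tensor K V' W') f (tensor_map K V' W' g h)
      (pure_tensor K U (tensor K V W) u (pure_tensor K V W v w)) =
    pure_tensor K U' (tensor K V' W') (f u) (pure_tensor K V' W' (g v) (h w))"
    using uvw by (simp add: tensor_map_pure[where W = "tensor K V W"] tensor_map_pure[where V = V]
        modules maps pure_closed)
  ultimately show "tensor_assoc K U' V' W'
      (tensor_map K (tensor K U' V') W' (tensor_map K U' V' f g) h
        (pure_tensor K (tensor K U V) W (pure_tensor K U V u v) w)) =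
    tensor_map K U' (tensor K V' W') f (tensor_map K V' W' g h)
      (tensor_assoc K U V W (pure_tensor K (tensor K U V) W (pure_tensor K U V u v) w))"
    using uvw uvw' by (simp add: tensor_assoc_pure UVW UVW')
qed


section \<open>Algebra structure on the tensor product\<close>

lemma tensor_algebra_simps:
  "carrier (tensor_algebra K A C) = carrier (tensor K A C)"
  "add (tensor_algebra K A C) = add (tensor K A C)"
  "\<one>\<^bsub>tensor_algebra K A C\<^esub> = pure_tensor K A C \<one>\<^bsub>A\<^esub> \<one>\<^bsub>C\<^esub>"
  by (simp_all add: tensor_algebra_def)

lemma bilinear_map_mult:
  assumes "unital_algebra K A"
  shows "bilinear_map K A A A (monoid.mult A)"
proof -
  interpret unital_algebra K A by fact
  show ?thesis
    by (intro bilinear_mapI linear_mapI)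
      (simp_all add: l_distr r_distr smult_mult_left smult_mult_right)
qed

context
  fixes K :: "('k, 'r) ring_scheme" and A :: "('k, 'a, 'm) module_scheme"
    and C :: "('k, 'c, 'n) module_scheme"
  assumes A: "unital_algebra K A" and C: "unital_algebra K C"
begin

private lemmas A_mod = unital_algebra.axioms(2)[OF A] and C_mod = unital_algebra.axioms(2)[OF C]

private lemmas T_mod = module_tensor[OF A_mod C_mod]

lemma bilinear_map_tensor_mult_inner:
  assumes "a \<in> carrier A" "b \<in> carrier C"
  shows "bilinear_map K A C (tensor K A C)
    (\<lambda>c d. pure_tensor K A C (a \<otimes>\<^bsub>A\<^esub> c) (b \<otimes>\<^bsub>C\<^esub> d))"
  by (rule bilinear_map_compose[OF bilinear_map_pure_tensor[OF A_mod C_mod]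
        bilinear_map_right[OF bilinear_map_mult[OF A] assms(1)]
        bilinear_map_right[OF bilinear_map_mult[OF C] assms(2)]])

text \<open>
  For fixed \<open>t\<close> this is \<open>(a, b) \<mapsto> (a \<otimes> b) t\<close>, the bilinear map that the outer lift in
  \<open>tensor_algebra\<close> extends.
\<close>

lemma bilinear_map_tensor_mult_outer:
  assumes t: "t \<in> carrier (tensor K A C)"
  shows "bilinear_map K A C (tensor K A C)
    (\<lambda>a b. tensor_lift K (tensor K A C)
      (\<lambda>c d. pure_tensor K A C (a \<otimes>\<^bsub>A\<^esub> c) (b \<otimes>\<^bsub>C\<^esub> d)) t)"
proof (rule bilinear_mapI)
  note pure = bilinear_map_pure_tensor[OF A_mod C_mod]
  note left_mult = bilinear_map_left[OF bilinear_map_mult]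
  note closed = bilinear_map_closed[OF bilinear_map_mult]
  show "linear_map K C (tensor K A C) (\<lambda>b. tensor_lift K (tensor K A C)
      (\<lambda>c d. pure_tensor K A C (a \<otimes>\<^bsub>A\<^esub> c) (b \<otimes>\<^bsub>C\<^esub> d)) t)" if a: "a \<in> carrier A" for a
    by (rule bilinear_map_left[OF bilinear_map_tensor_lift[OF A_mod C_mod T_mod
            bilinear_map_tensor_mult_inner[OF a] _ C_mod] t])
      (assumption, rule linear_map_comp[OF left_mult[OF C] bilinear_map_right[OF pure closed[OF A a]]])
  show "linear_map K A (tensor K A C) (\<lambda>a. tensor_lift K (tensor K A C)
      (\<lambda>c d. pure_tensor K A C (a \<otimes>\<^bsub>A\<^esub> c) (b \<otimes>\<^bsub>C\<^esub> d)) t)" if b: "b \<in> carrier C" for b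
    by (rule bilinear_map_left[OF bilinear_map_tensor_lift[OF A_mod C_mod T_mod
            bilinear_map_tensor_mult_inner[OF _ b] _ A_mod] t])
      (assumption, rule linear_map_comp[OF left_mult[OF A] bilinear_map_left[OF pure closed[OF C b]]])
qed

lemma bilinear_map_tensor_mult:
  "bilinear_map K (tensor K A C) (tensor K A C) (tensor K A C) (monoid.mult (tensor_algebra K A C))"
proof -
  have "bilinear_map K (tensor K A C) (tensor K A C) (tensor K A C)
    (\<lambda>t. tensor_lift K (tensor K A C) (\<lambda>a b. tensor_lift K (tensor K A C)
      (\<lambda>c d. pure_tensor K A C (a \<otimes>\<^bsub>A\<^esub> c) (b \<otimes>\<^bsub>C\<^esub> d)) t))"
    by (rule bilinear_map_tensor_lift[OF A_mod C_mod T_mod bilinear_map_tensor_mult_outer _ T_mod])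
      (assumption, rule linear_map_tensor_lift[OF A_mod C_mod T_mod bilinear_map_tensor_mult_inner])
  from bilinear_map_flip[OF this] show ?thesis
    by (simp add: tensor_algebra_def)
qed

lemma tensor_mult_pure:
  assumes "a \<in> carrier A" "b \<in> carrier C" "c \<in> carrier A" "d \<in> carrier C"
  shows "pure_tensor K A C a b \<otimes>\<^bsub>tensor_algebra K A C\<^esub> pure_tensor K A C c d =
    pure_tensor K A C (a \<otimes>\<^bsub>A\<^esub> c) (b \<otimes>\<^bsub>C\<^esub> d)"
proof -
  note pure = bilinear_map_pure_tensor[OF A_mod C_mod]
  show ?thesis
    using assms
    by (simp add: tensor_algebra_def
        tensor_lift_pure[OF A_mod C_mod T_mod bilinear_map_tensor_mult_outer]
        tensor_lift_pure[OF A_mod C_mod T_mod bilinear_map_tensor_mult_inner]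
        bilinear_map_closed[OF pure])
qed

end


section \<open>Subspaces spanned by pure tensors\<close>

lemma tensor_subspace_eqI:
  assumes V: "module K V" and W: "module K W" and U: "module K U"
    and f: "linear_map K (tensor K V W) U f" and g: "linear_map K (tensor K V W) U g"
    and S: "S \<subseteq> carrier V" "S' \<subseteq> carrier W"
    and eq: "\<And>v w. v \<in> S \<Longrightarrow> w \<in> S' \<Longrightarrow> f (pure_tensor K V W v w) = g (pure_tensor K V W v w)"
    and t: "t \<in> tensor_subspace K V W S S'"
  shows "t \<in> carrier (tensor K V W)" "f t = g t"
proof -
  have pure: "pure_tensor K V W v w \<in> carrier (tensor K V W)" if "v \<in> S" "w \<in> S'" for v w
    using that S by (intro bilinear_map_closed[OF bilinear_map_pure_tensor[OF V W]]) auto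
  have "tensor_subspace K V W S S' \<subseteq> {t \<in> carrier (tensor K V W). f t = g t}"
    unfolding tensor_subspace_def
    using pure eq
    by (intro hull_minimal submodule_equalizer[OF module_tensor[OF V W] U f g]) blast
  then show "t \<in> carrier (tensor K V W)" "f t = g t" using t by auto
qed

lemma tensor_subspace_sum_eqI:
  assumes V: "module K V" and W: "module K W" and U: "module K U"
    and f: "linear_map K (tensor K V W) U f" and g: "linear_map K (tensor K V W) U g"
    and S: "S \<subseteq> carrier V" "S' \<subseteq> carrier W" and R: "R \<subseteq> carrier V" "R' \<subseteq> carrier W"
    and eq_S: "\<And>v w. v \<in> S \<Longrightarrow> w \<in> S' \<Longrightarrow> f (pure_tensor K V W v w) = g (pure_tensor K V W v w)"
    and eq_R: "\<And>v w. v \<in> R \<Longrightarrow> w \<in> R' \<Longrightarrow> f (pure_tensor K V W v w) = g (pure_tensor K V W v w)"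
    and t: "t \<in> tensor_subspace K V W S S' <+>\<^bsub>tensor K V W\<^esub> tensor_subspace K V W R R'"
  shows "f t = g t"
proof -
  from t obtain x y where t: "t = x \<oplus>\<^bsub>tensor K V W\<^esub> y"
    and x: "x \<in> tensor_subspace K V W S S'" and y: "y \<in> tensor_subspace K V W R R'"
    unfolding set_add_def' by blast
  note x' = tensor_subspace_eqI[OF V W U f g S eq_S x]
    and y' = tensor_subspace_eqI[OF V W U f g R eq_R y]
  show ?thesis
    using x' y' by (simp add: t linear_map_add[OF f] linear_map_add[OF g])
qed


section \<open>Linear retractions onto subspaces\<close>

text \<open>
  By Zorn's lemma there is a maximal subspace \<open>N\<close> with \<open>N \<inter> W = 0\<close>. If \<open>v\<close> were outside \<open>N + W\<close>, then
  the larger space \<open>N + K v\<close> would still meet \<open>W\<close> only in \<open>0\<close>, against maximality: a nonzero \<open>w = n + k v\<close>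
  in \<open>W\<close> has \<open>k \<noteq> 0\<close>, and dividing by \<open>k\<close> puts \<open>v\<close> into \<open>N + W\<close>.
\<close>

lemma subspace_complement:
  assumes "field K" and V: "module K V" and W: "submodule W K V"
  obtains N where "submodule N K V" "N \<inter> W = {\<zero>\<^bsub>V\<^esub>}"
    "\<And>v. v \<in> carrier V \<Longrightarrow> \<exists>n\<in>N. \<exists>w\<in>W. v = n \<oplus>\<^bsub>V\<^esub> w"
proof -
  interpret K: field K by fact
  interpret V: module K V by fact
  let ?\<N> = "{N. submodule N K V \<and> N \<inter> W = {\<zero>\<^bsub>V\<^esub>}}"
  have zero: "\<zero>\<^bsub>V\<^esub> \<in> N" if "submodule N K V" for N
    using subgroup.one_closed[OF submodule.axioms(1)[OF that]] by simp
  note closed = V.submoduleE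
  have "submodule {\<zero>\<^bsub>V\<^esub>} K V" by (rule V.submoduleI) auto
  then have "{\<zero>\<^bsub>V\<^esub>} \<in> ?\<N>" using zero[OF W] by auto
  then have "?\<N> \<noteq> {}" by blast
  moreover have "\<Union>\<C> \<in> ?\<N>" if "\<C> \<noteq> {}" "subset.chain ?\<N> \<C>" for \<C>
  proof -
    from that(2) have sub: "\<And>N. N \<in> \<C> \<Longrightarrow> submodule N K V" "\<And>N. N \<in> \<C> \<Longrightarrow> N \<inter> W = {\<zero>\<^bsub>V\<^esub>}"
      and chain: "\<And>M N. M \<in> \<C> \<Longrightarrow> N \<in> \<C> \<Longrightarrow> M \<subseteq> N \<or> N \<subseteq> M"
      by (auto simp: subset.chain_def)
    have "submodule (\<Union>\<C>) K V"
    proof (rule V.submoduleI)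
      show "\<Union>\<C> \<subseteq> carrier V" using closed(1)[OF sub(1)] by blast
      show "\<zero>\<^bsub>V\<^esub> \<in> \<Union>\<C>" using that(1) zero[OF sub(1)] by blast
      show "\<ominus>\<^bsub>V\<^esub> a \<in> \<Union>\<C>" if "a \<in> \<Union>\<C>" for a using that closed(3)[OF sub(1)] by blast
      show "k \<odot>\<^bsub>V\<^esub> a \<in> \<Union>\<C>" if "k \<in> carrier K" "a \<in> \<Union>\<C>" for k a
        using that closed(4)[OF sub(1)] by blast
      show "a \<oplus>\<^bsub>V\<^esub> b \<in> \<Union>\<C>" if "a \<in> \<Union>\<C>" "b \<in> \<Union>\<C>" for a b
      proof -
        from that obtain M N where MN: "M \<in> \<C>" "a \<in> M" "N \<in> \<C>" "b \<in> N" by blast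
        then show ?thesis using chain[OF MN(1,3)] closed(5)[OF sub(1)] by blast
      qed
    qed
    moreover have "\<Union>\<C> \<inter> W = {\<zero>\<^bsub>V\<^esub>}" using that(1) sub(2) by blast
    ultimately show ?thesis by blast
  qed
  ultimately have "\<exists>N\<in>?\<N>. \<forall>X\<in>?\<N>. N \<subseteq> X \<longrightarrow> X = N"
    by (rule subset_Zorn_nonempty)
  then obtain N where N: "submodule N K V" and NW: "N \<inter> W = {\<zero>\<^bsub>V\<^esub>}"
    and max: "\<And>X. submodule X K V \<Longrightarrow> X \<inter> W = {\<zero>\<^bsub>V\<^esub>} \<Longrightarrow> N \<subseteq> X \<Longrightarrow> X = N"
    by auto
  note N_carr = subsetD[OF closed(1)[OF N]] and W_carr = subsetD[OF closed(1)[OF W]]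
  have "\<exists>n\<in>N. \<exists>w\<in>W. v = n \<oplus>\<^bsub>V\<^esub> w" if v: "v \<in> carrier V" for v
  proof -
    define X where "X = {n \<oplus>\<^bsub>V\<^esub> k \<odot>\<^bsub>V\<^esub> v | n k. n \<in> N \<and> k \<in> carrier K}"
    have X_I: "n \<oplus>\<^bsub>V\<^esub> k \<odot>\<^bsub>V\<^esub> v \<in> X" if "n \<in> N" "k \<in> carrier K" for n k
      unfolding X_def using that by blast
    have X_E: "\<exists>n k. n \<in> N \<and> k \<in> carrier K \<and> x = n \<oplus>\<^bsub>V\<^esub> k \<odot>\<^bsub>V\<^esub> v" if "x \<in> X" for x
      using that unfolding X_def by blast
    have "submodule X K V"
    proof (rule V.submoduleI)
      show "X \<subseteq> carrier V" unfolding X_def using N_carr v by auto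
      show "\<zero>\<^bsub>V\<^esub> \<in> X" using X_I[OF zero[OF N] K.zero_closed] v by simp
      show "\<ominus>\<^bsub>V\<^esub> a \<in> X" if a: "a \<in> X" for a
      proof -
        obtain n k where nk: "n \<in> N" "k \<in> carrier K" "a = n \<oplus>\<^bsub>V\<^esub> k \<odot>\<^bsub>V\<^esub> v" using X_E[OF a] by blast
        then have "\<ominus>\<^bsub>V\<^esub> a = \<ominus>\<^bsub>V\<^esub> n \<oplus>\<^bsub>V\<^esub> (\<ominus>\<^bsub>K\<^esub> k) \<odot>\<^bsub>V\<^esub> v"
          using N_carr v by (simp add: V.minus_add V.smult_l_minus)
        then show ?thesis using X_I[of "\<ominus>\<^bsub>V\<^esub> n" "\<ominus>\<^bsub>K\<^esub> k"] nk closed(3)[OF N] by simp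
      qed
      show "a \<oplus>\<^bsub>V\<^esub> b \<in> X" if a: "a \<in> X" and b: "b \<in> X" for a b
      proof -
        obtain n k where nk: "n \<in> N" "k \<in> carrier K" "a = n \<oplus>\<^bsub>V\<^esub> k \<odot>\<^bsub>V\<^esub> v" using X_E[OF a] by blast
        obtain m l where ml: "m \<in> N" "l \<in> carrier K" "b = m \<oplus>\<^bsub>V\<^esub> l \<odot>\<^bsub>V\<^esub> v" using X_E[OF b] by blast
        have "a \<oplus>\<^bsub>V\<^esub> b = (n \<oplus>\<^bsub>V\<^esub> m) \<oplus>\<^bsub>V\<^esub> (k \<oplus>\<^bsub>K\<^esub> l) \<odot>\<^bsub>V\<^esub> v"
          using nk ml N_carr v by (simp add: V.smult_l_distr V.a_ac)
        then show ?thesis using X_I[of "n \<oplus>\<^bsub>V\<^esub> m" "k \<oplus>\<^bsub>K\<^esub> l"] nk ml closed(5)[OF N] by simp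
      qed
      show "l \<odot>\<^bsub>V\<^esub> a \<in> X" if l: "l \<in> carrier K" and a: "a \<in> X" for l a
      proof -
        obtain n k where nk: "n \<in> N" "k \<in> carrier K" "a = n \<oplus>\<^bsub>V\<^esub> k \<odot>\<^bsub>V\<^esub> v" using X_E[OF a] by blast
        have "l \<odot>\<^bsub>V\<^esub> a = l \<odot>\<^bsub>V\<^esub> n \<oplus>\<^bsub>V\<^esub> (l \<otimes>\<^bsub>K\<^esub> k) \<odot>\<^bsub>V\<^esub> v"
          using nk l N_carr v by (simp add: V.smult_r_distr V.smult_assoc1)
        then show ?thesis using X_I[of "l \<odot>\<^bsub>V\<^esub> n" "l \<otimes>\<^bsub>K\<^esub> k"] nk l closed(4)[OF N] by simp
      qed
    qed
    have "n \<in> X" if "n \<in> N" for n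
      using X_I[OF that K.zero_closed] N_carr[OF that] v by simp
    then have NX: "N \<subseteq> X" by blast
    (* If X meets W only in zero, then X = N by maximality, so v lies in N; otherwise a nonzero
       common element of X and W expresses v. *)
    show ?thesis
    proof (cases "X \<inter> W = {\<zero>\<^bsub>V\<^esub>}")
      case True
      have "\<zero>\<^bsub>V\<^esub> \<oplus>\<^bsub>V\<^esub> \<one>\<^bsub>K\<^esub> \<odot>\<^bsub>V\<^esub> v \<in> X" by (intro X_I zero N K.one_closed)
      then have "v \<in> N" using max[OF \<open>submodule X K V\<close> True NX] v by simp
      then show ?thesis using zero[OF W] v by (intro bexI[of _ v] bexI[of _ "\<zero>\<^bsub>V\<^esub>"]) auto
    next
      case False
      moreover have "\<zero>\<^bsub>V\<^esub> \<in> X \<inter> W" using zero[OF W] zero[OF \<open>submodule X K V\<close>] by simp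
      ultimately obtain w where w: "w \<in> X" "w \<in> W" "w \<noteq> \<zero>\<^bsub>V\<^esub>" by blast
      obtain n k where nk: "n \<in> N" "k \<in> carrier K" "w = n \<oplus>\<^bsub>V\<^esub> k \<odot>\<^bsub>V\<^esub> v" using X_E[OF w(1)] by blast
      have "k \<noteq> \<zero>\<^bsub>K\<^esub>"
      proof
        assume "k = \<zero>\<^bsub>K\<^esub>"
        then have "w = n" using nk N_carr v by simp
        then show False using NW nk(1) w(2,3) by blast
      qed
      then have k: "k \<in> Units K" using nk(2) by (simp add: K.field_Units)
      let ?j = "inv\<^bsub>K\<^esub> k"
      have j: "?j \<in> carrier K" "?j \<otimes>\<^bsub>K\<^esub> k = \<one>\<^bsub>K\<^esub>" using k by auto
      have "?j \<odot>\<^bsub>V\<^esub> w = ?j \<odot>\<^bsub>V\<^esub> n \<oplus>\<^bsub>V\<^esub> (?j \<otimes>\<^bsub>K\<^esub> k) \<odot>\<^bsub>V\<^esub> v"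
        using nk j(1) N_carr v by (simp add: V.smult_r_distr V.smult_assoc1)
      then have "?j \<odot>\<^bsub>V\<^esub> w = ?j \<odot>\<^bsub>V\<^esub> n \<oplus>\<^bsub>V\<^esub> v" using j v by simp
      then have "v = \<ominus>\<^bsub>V\<^esub> (?j \<odot>\<^bsub>V\<^esub> n) \<oplus>\<^bsub>V\<^esub> ?j \<odot>\<^bsub>V\<^esub> w"
        using j(1) nk(1) N_carr v by (simp add: V.r_neg1)
      moreover have "\<ominus>\<^bsub>V\<^esub> (?j \<odot>\<^bsub>V\<^esub> n) \<in> N" using j(1) nk(1) closed(3,4)[OF N] by blast
      moreover have "?j \<odot>\<^bsub>V\<^esub> w \<in> W" using j(1) w(2) closed(4)[OF W] by blast
      ultimately show ?thesis by blast
    qed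
  qed
  then show thesis using that N NW by blast
qed

text \<open>
  The projection onto \<open>W\<close> along a complement.
\<close>

lemma linear_retraction:
  assumes "field K" and V: "module K V" and W: "submodule W K V"
  obtains r where "linear_map K V (V\<lparr>carrier := W\<rparr>) r" "\<And>w. w \<in> W \<Longrightarrow> r w = w"
proof -
  interpret V: module K V by fact
  obtain N where N: "submodule N K V" and NW: "N \<inter> W = {\<zero>\<^bsub>V\<^esub>}"
    and sum: "\<And>v. v \<in> carrier V \<Longrightarrow> \<exists>n\<in>N. \<exists>w\<in>W. v = n \<oplus>\<^bsub>V\<^esub> w"
    using subspace_complement[OF assms] by blast
  note cN = V.submoduleE[OF N] and cW = V.submoduleE[OF W]
  note N_carr = subsetD[OF cN(1)] and W_carr = subsetD[OF cW(1)]
  have zeroN: "\<zero>\<^bsub>V\<^esub> \<in> N" using NW by blast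
  define r where "r v = (THE w. w \<in> W \<and> (\<exists>n\<in>N. v = n \<oplus>\<^bsub>V\<^esub> w))" for v
  have r_eq: "r (n \<oplus>\<^bsub>V\<^esub> w) = w" if nw: "n \<in> N" "w \<in> W" for n w
    unfolding r_def
  proof (rule the_equality)
    show "w \<in> W \<and> (\<exists>m\<in>N. n \<oplus>\<^bsub>V\<^esub> w = m \<oplus>\<^bsub>V\<^esub> w)" using nw by blast
    fix w' assume "w' \<in> W \<and> (\<exists>m\<in>N. n \<oplus>\<^bsub>V\<^esub> w = m \<oplus>\<^bsub>V\<^esub> w')"
    then obtain m where w': "w' \<in> W" and m: "m \<in> N" and eq: "n \<oplus>\<^bsub>V\<^esub> w = m \<oplus>\<^bsub>V\<^esub> w'" by blast
    note carr = N_carr[OF nw(1)] N_carr[OF m] W_carr[OF nw(2)] W_carr[OF w']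
    have "w' \<oplus>\<^bsub>V\<^esub> \<ominus>\<^bsub>V\<^esub> w = \<ominus>\<^bsub>V\<^esub> m \<oplus>\<^bsub>V\<^esub> (m \<oplus>\<^bsub>V\<^esub> w') \<oplus>\<^bsub>V\<^esub> \<ominus>\<^bsub>V\<^esub> w"
      using carr by (simp add: V.r_neg1)
    also have "\<dots> = \<ominus>\<^bsub>V\<^esub> m \<oplus>\<^bsub>V\<^esub> n"
      using carr by (simp add: eq[symmetric] V.a_assoc V.r_neg)
    finally have "w' \<oplus>\<^bsub>V\<^esub> \<ominus>\<^bsub>V\<^esub> w \<in> N" using cN(3)[OF m] nw(1) cN(5) by simp
    moreover have "w' \<oplus>\<^bsub>V\<^esub> \<ominus>\<^bsub>V\<^esub> w \<in> W" using w' cW(3)[OF nw(2)] cW(5) by simp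
    ultimately have "w' \<oplus>\<^bsub>V\<^esub> \<ominus>\<^bsub>V\<^esub> w = \<zero>\<^bsub>V\<^esub>" using NW by blast
    then show "w' = w" using carr V.minus_equality[of w' "\<ominus>\<^bsub>V\<^esub> w"] by simp
  qed
  have "linear_map K V (V\<lparr>carrier := W\<rparr>) r"
  proof (rule linear_mapI)
    fix x assume "x \<in> carrier V"
    then obtain n w where x: "x = n \<oplus>\<^bsub>V\<^esub> w" "n \<in> N" "w \<in> W" using sum by blast
    then show "r x \<in> carrier (V\<lparr>carrier := W\<rparr>)" by (simp add: r_eq)
    note carr = N_carr[OF x(2)] W_carr[OF x(3)]
    show "r (k \<odot>\<^bsub>V\<^esub> x) = k \<odot>\<^bsub>V\<lparr>carrier := W\<rparr>\<^esub> r x" if "k \<in> carrier K" for k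
      using x carr that r_eq[OF cN(4)[OF that x(2)] cW(4)[OF that x(3)]]
      by (simp add: r_eq V.smult_r_distr)
    fix y assume "y \<in> carrier V"
    then obtain m u where y: "y = m \<oplus>\<^bsub>V\<^esub> u" "m \<in> N" "u \<in> W" using sum by blast
    have "x \<oplus>\<^bsub>V\<^esub> y = (n \<oplus>\<^bsub>V\<^esub> m) \<oplus>\<^bsub>V\<^esub> (w \<oplus>\<^bsub>V\<^esub> u)"
      using x(1) y(1) carr N_carr[OF y(2)] W_carr[OF y(3)] by (simp add: V.a_ac)
    then show "r (x \<oplus>\<^bsub>V\<^esub> y) = r x \<oplus>\<^bsub>V\<lparr>carrier := W\<rparr>\<^esub> r y"
      using r_eq[OF cN(5)[OF x(2) y(2)] cW(5)[OF x(3) y(3)]] x y by (simp add: r_eq)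
  qed
  moreover have "r w = w" if "w \<in> W" for w
    using r_eq[OF zeroN that] W_carr[OF that] by simp
  ultimately show thesis using that by blast
qed


section \<open>Bialgebra structures on images of subalgebras\<close>

text \<open>
  The map \<open>\<rho>\<close> is linear on all of \<open>A\<close>, so that \<open>\<rho> \<otimes> \<rho>\<close> can be applied to \<open>\<Delta> b\<close>, whose component in \<open>I \<otimes> A\<close> is
  not confined to \<open>B \<otimes> B\<close>; but only its restriction to \<open>B\<close> is assumed to be multiplicative, with kernel \<open>I\<close>.
\<close>

locale bialgebra_subquotient =
  fixes K :: "('k, 'r) ring_scheme" and A :: "('k, 'a, 'm) module_scheme"
    and \<Delta> :: "'a \<Rightarrow> ('a \<times> 'a \<Rightarrow> 'k) set" and \<epsilon> :: "'a \<Rightarrow> 'k"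
    and B I :: "'a set" and Q :: "('k, 'q, 'n) module_scheme" and \<rho> :: "'a \<Rightarrow> 'q"
  assumes bialg: "bialgebra K A \<Delta> \<epsilon>" and Q: "unital_algebra K Q"
    and B: "subring B A" "submodule B K A" and I_sub: "I \<subseteq> B"
    and \<rho>: "linear_map K A Q \<rho>" and \<rho>_B: "\<rho> ` B = carrier Q"
    and \<rho>_one: "\<rho> \<one>\<^bsub>A\<^esub> = \<one>\<^bsub>Q\<^esub>"
    and \<rho>_mult: "\<And>b c. b \<in> B \<Longrightarrow> c \<in> B \<Longrightarrow> \<rho> (b \<otimes>\<^bsub>A\<^esub> c) = \<rho> b \<otimes>\<^bsub>Q\<^esub> \<rho> c"
    and \<rho>_ker: "\<And>b. b \<in> B \<Longrightarrow> \<rho> b = \<zero>\<^bsub>Q\<^esub> \<longleftrightarrow> b \<in> I"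
    and \<epsilon>_I: "\<And>i. i \<in> I \<Longrightarrow> \<epsilon> i = \<zero>\<^bsub>K\<^esub>"
    and \<Delta>_B: "\<And>b. b \<in> B \<Longrightarrow> \<Delta> b \<in>
      tensor_subspace K A A B B <+>\<^bsub>tensor K A A\<^esub> tensor_subspace K A A I (carrier A)"
    and \<Delta>_I: "\<And>i. i \<in> I \<Longrightarrow> \<Delta> i \<in>
      tensor_subspace K A A B I <+>\<^bsub>tensor K A A\<^esub> tensor_subspace K A A I (carrier A)"
begin

interpretation A: bialgebra K A \<Delta> \<epsilon> by (rule bialg)
interpretation Q: unital_algebra K Q by (rule Q)

abbreviation (input) "\<Phi> \<equiv> tensor_map K Q Q \<rho> \<rho>"
abbreviation (input) "TA \<equiv> tensor K A A"
abbreviation (input) "TQ \<equiv> tensor K Q Q"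

lemmas A_mod = A.module_axioms and Q_mod = Q.module_axioms
lemmas TA_mod = module_tensor[OF A_mod A_mod] and TQ_mod = module_tensor[OF Q_mod Q_mod]
lemmas B_carrier = subsetD[OF subringE(1)[OF B(1)]]
lemmas pure_Q = bilinear_map_pure_tensor[OF Q_mod Q_mod]
lemmas \<rho>_closed = linear_map_closed[OF \<rho>]
lemmas \<Phi> = linear_map_tensor_map[OF A_mod A_mod Q_mod Q_mod \<rho> \<rho>]
lemmas \<Phi>_pure = tensor_map_pure[OF A_mod A_mod Q_mod Q_mod \<rho> \<rho>]

lemma I_carrier: "i \<in> I \<Longrightarrow> i \<in> carrier A"
  using I_sub B_carrier by blast

lemma \<rho>_I: "i \<in> I \<Longrightarrow> \<rho> i = \<zero>\<^bsub>Q\<^esub>"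
  using \<rho>_ker I_sub by blast

lemma comult_linear: "linear_map K A TA \<Delta>"
  using ring_hom_closed[OF A.comult_hom] ring_hom_add[OF A.comult_hom]
  by (intro linear_mapI A.comult_smult) (simp_all add: tensor_algebra_simps)

text \<open>
  The principle behind all axioms below: identities between linear maps on \<open>A \<otimes> A\<close> hold at \<open>\<Delta> b\<close> as soon
  as they hold on the generators of \<open>B \<otimes> B + I \<otimes> A\<close>.
\<close>

lemma comult_eqI:
  assumes "module K U" "linear_map K TA U f" "linear_map K TA U g"
    and "\<And>x y. x \<in> B \<Longrightarrow> y \<in> B \<Longrightarrow> f (pure_tensor K A A x y) = g (pure_tensor K A A x y)"
    and "\<And>x y. x \<in> I \<Longrightarrow> y \<in> carrier A \<Longrightarrow> f (pure_tensor K A A x y) = g (pure_tensor K A A x y)"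
    and "b \<in> B"
  shows "f (\<Delta> b) = g (\<Delta> b)"
  using I_carrier B_carrier
  by (intro tensor_subspace_sum_eqI[OF A_mod A_mod assms(1-3) _ _ _ _ assms(4,5) \<Delta>_B[OF assms(6)]])
    auto

text \<open>
  On generators of \<open>B \<otimes> I\<close> and of \<open>I \<otimes> A\<close> one of the two factors is killed by \<open>\<rho>\<close>. This makes the induced
  coproduct well defined.
\<close>

lemma \<Phi>_comult_I:
  assumes "i \<in> I"
  shows "\<Phi> (\<Delta> i) = \<zero>\<^bsub>TQ\<^esub>"
  using I_carrier B_carrier
  by (intro tensor_subspace_sum_eqI[OF A_mod A_mod TQ_mod \<Phi> linear_map_const_zero[OF TQ_mod]
        _ _ _ _ _ _ \<Delta>_I[OF assms]])
    (auto simp: \<Phi>_pure \<rho>_I \<rho>_closed bilinear_map_zero[OF Q_mod Q_mod TQ_mod pure_Q])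

lemma \<rho>_eqD:
  assumes "b \<in> B" "c \<in> B" "\<rho> b = \<rho> c"
  obtains i where "i \<in> I" "b = i \<oplus>\<^bsub>A\<^esub> c"
proof
  note carr = B_carrier[OF assms(1)] B_carrier[OF assms(2)]
  have "b \<ominus>\<^bsub>A\<^esub> c \<in> B"
    unfolding a_minus_def using assms(1,2) subringE(5,7)[OF B(1)] by blast
  moreover have "\<rho> (b \<ominus>\<^bsub>A\<^esub> c) = \<zero>\<^bsub>Q\<^esub>"
    using linear_map_minus[OF A_mod Q_mod \<rho> carr] \<rho>_closed[OF carr(2)] assms(3)
    by (simp add: a_minus_def[of Q] Q.r_neg)
  ultimately show "b \<ominus>\<^bsub>A\<^esub> c \<in> I" using \<rho>_ker by blast
  show "b = (b \<ominus>\<^bsub>A\<^esub> c) \<oplus>\<^bsub>A\<^esub> c"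
    using carr by (simp add: a_minus_def A.a_assoc A.l_neg)
qed

lemma \<Phi>_comult_cong:
  assumes "b \<in> B" "c \<in> B" "\<rho> b = \<rho> c"
  shows "\<Phi> (\<Delta> b) = \<Phi> (\<Delta> c)"
proof -
  interpret TQ: module K TQ by (rule TQ_mod)
  obtain i where i: "i \<in> I" "b = i \<oplus>\<^bsub>A\<^esub> c" using \<rho>_eqD[OF assms] .
  note \<Phi>\<Delta> = linear_map_comp[OF comult_linear \<Phi>]
  show ?thesis
    using linear_map_add[OF \<Phi>\<Delta> I_carrier[OF i(1)] B_carrier[OF assms(2)]]
      linear_map_closed[OF \<Phi>\<Delta> B_carrier[OF assms(2)]]
    by (simp add: i(2) \<Phi>_comult_I[OF i(1)])
qed

lemma counit_cong:
  assumes "b \<in> B" "c \<in> B" "\<rho> b = \<rho> c"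
  shows "\<epsilon> b = \<epsilon> c"
proof -
  obtain i where i: "i \<in> I" "b = i \<oplus>\<^bsub>A\<^esub> c" using \<rho>_eqD[OF assms] .
  show ?thesis
    using ring_hom_add[OF A.counit_hom I_carrier[OF i(1)] B_carrier[OF assms(2)]]
      ring_hom_closed[OF A.counit_hom B_carrier[OF assms(2)]]
    by (simp add: i(2) \<epsilon>_I[OF i(1)])
qed

text \<open>
  On generators, \<open>(x \<otimes> y)(u \<otimes> v) = xu \<otimes> yv\<close>. If both generators lie in \<open>B \<otimes> B\<close>, multiplicativity of \<open>\<rho>\<close> on \<open>B\<close>
  applies to both factors. Otherwise \<open>x\<close> or \<open>u\<close> lies in \<open>I\<close>; then \<open>\<rho> (xu) = \<rho> x \<rho> u = 0\<close>, so both
  sides vanish, whatever \<open>\<rho>\<close> does to the product \<open>yv\<close> outside \<open>B\<close>. The general case follows by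
  extending in one factor at a time.
\<close>

lemma \<Phi>_mult:
  assumes "b \<in> B" "c \<in> B"
  shows "\<Phi> (\<Delta> b \<otimes>\<^bsub>tensor_algebra K A A\<^esub> \<Delta> c) =
    \<Phi> (\<Delta> b) \<otimes>\<^bsub>tensor_algebra K Q Q\<^esub> \<Phi> (\<Delta> c)"
proof -
  note mult_A = bilinear_map_tensor_mult[OF A.unital_algebra_axioms A.unital_algebra_axioms]
    and mult_Q = bilinear_map_tensor_mult[OF Q Q]
  note mult_pure = tensor_mult_pure[OF A.unital_algebra_axioms A.unital_algebra_axioms]
    tensor_mult_pure[OF Q Q]
  note pure_A_closed = bilinear_map_closed[OF bilinear_map_pure_tensor[OF A_mod A_mod]]
  note pure_zero = bilinear_map_zero(1)[OF Q_mod Q_mod TQ_mod pure_Q]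
  note \<Phi>_closed = linear_map_closed[OF \<Phi>]
  have \<Delta>_closed: "\<Delta> x \<in> carrier TA" if "x \<in> B" for x
    using linear_map_closed[OF comult_linear B_carrier[OF that]] .
  have BB: "x \<otimes>\<^bsub>A\<^esub> y \<in> B" if "x \<in> B" "y \<in> B" for x y
    using subringE(6)[OF B(1)] that .
  have pure: "\<Phi> (pure_tensor K A A x y \<otimes>\<^bsub>tensor_algebra K A A\<^esub> pure_tensor K A A u v) =
      \<Phi> (pure_tensor K A A x y) \<otimes>\<^bsub>tensor_algebra K Q Q\<^esub> \<Phi> (pure_tensor K A A u v)"
    if xu: "x \<in> B" "u \<in> B" and yv: "y \<in> carrier A" "v \<in> carrier A"
      and cases: "y \<in> B \<and> v \<in> B \<or> x \<in> I \<or> u \<in> I" for x y u v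
  proof -
    have "pure_tensor K Q Q (\<rho> x \<otimes>\<^bsub>Q\<^esub> \<rho> u) (\<rho> (y \<otimes>\<^bsub>A\<^esub> v)) =
        pure_tensor K Q Q (\<rho> x \<otimes>\<^bsub>Q\<^esub> \<rho> u) (\<rho> y \<otimes>\<^bsub>Q\<^esub> \<rho> v)"
      using cases
    proof (elim disjE)
      assume "x \<in> I"
      then show ?thesis using xu yv B_carrier by (simp add: \<rho>_I \<rho>_closed pure_zero)
    next
      assume "u \<in> I"
      then show ?thesis using xu yv B_carrier by (simp add: \<rho>_I \<rho>_closed pure_zero)
    qed (simp add: \<rho>_mult)
    then show ?thesis
      using xu yv B_carrier by (simp add: mult_pure \<Phi>_pure \<rho>_closed \<rho>_mult)
  qed
  have left: "linear_map K TA TQ (\<lambda>s. \<Phi> (s \<otimes>\<^bsub>tensor_algebra K A A\<^esub> t))"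
    "linear_map K TA TQ (\<lambda>s. \<Phi> s \<otimes>\<^bsub>tensor_algebra K Q Q\<^esub> \<Phi> t)" if "t \<in> carrier TA" for t
    using linear_map_comp[OF bilinear_map_left[OF mult_A that] \<Phi>]
      linear_map_comp[OF \<Phi> bilinear_map_left[OF mult_Q \<Phi>_closed[OF that]]] .
  have right: "linear_map K TA TQ (\<lambda>t. \<Phi> (s \<otimes>\<^bsub>tensor_algebra K A A\<^esub> t))"
    "linear_map K TA TQ (\<lambda>t. \<Phi> s \<otimes>\<^bsub>tensor_algebra K Q Q\<^esub> \<Phi> t)" if "s \<in> carrier TA" for s
    using linear_map_comp[OF bilinear_map_right[OF mult_A that] \<Phi>]
      linear_map_comp[OF \<Phi> bilinear_map_right[OF mult_Q \<Phi>_closed[OF that]]] .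
  have pure_comult: "\<Phi> (pure_tensor K A A x y \<otimes>\<^bsub>tensor_algebra K A A\<^esub> \<Delta> c) =
      \<Phi> (pure_tensor K A A x y) \<otimes>\<^bsub>tensor_algebra K Q Q\<^esub> \<Phi> (\<Delta> c)"
    if "x \<in> B" "y \<in> carrier A" "y \<in> B \<or> x \<in> I" for x y
    using that I_sub B_carrier
    by (intro comult_eqI[OF TQ_mod right[OF pure_A_closed] _ _ assms(2)] pure) auto
  show ?thesis
    using I_sub B_carrier
    by (intro comult_eqI[OF TQ_mod left[OF \<Delta>_closed[OF assms(2)]] _ _ assms(1)] pure_comult) auto
qed

theorem bialgebra_image:
  obtains \<Delta>' \<epsilon>' where "bialgebra K Q \<Delta>' \<epsilon>'"
    "\<And>b. b \<in> B \<Longrightarrow> \<Delta>' (\<rho> b) = \<Phi> (\<Delta> b)" "\<And>b. b \<in> B \<Longrightarrow> \<epsilon>' (\<rho> b) = \<epsilon> b"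
proof -
  define \<sigma> where "\<sigma> = inv_into B \<rho>"
  define \<Delta>' where "\<Delta>' q = \<Phi> (\<Delta> (\<sigma> q))" for q
  define \<epsilon>' where "\<epsilon>' q = \<epsilon> (\<sigma> q)" for q
  have \<sigma>: "\<sigma> (\<rho> b) \<in> B" "\<rho> (\<sigma> (\<rho> b)) = \<rho> b" if "b \<in> B" for b
    using that inv_into_into[of "\<rho> b" \<rho> B] f_inv_into_f[of "\<rho> b" \<rho> B] by (auto simp: \<sigma>_def)
  have \<Delta>'_\<rho>: "\<Delta>' (\<rho> b) = \<Phi> (\<Delta> b)" if "b \<in> B" for b
    unfolding \<Delta>'_def by (rule \<Phi>_comult_cong[OF \<sigma>(1)[OF that] that \<sigma>(2)[OF that]])
  have \<epsilon>'_\<rho>: "\<epsilon>' (\<rho> b) = \<epsilon> b" if "b \<in> B" for b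
    unfolding \<epsilon>'_def by (rule counit_cong[OF \<sigma>(1)[OF that] that \<sigma>(2)[OF that]])
  have Q_E: "\<exists>b\<in>B. q = \<rho> b" if "q \<in> carrier Q" for q
    using that \<rho>_B by blast
  have B_closed: "b \<otimes>\<^bsub>A\<^esub> c \<in> B" "b \<oplus>\<^bsub>A\<^esub> c \<in> B" "k \<in> carrier K \<Longrightarrow> k \<odot>\<^bsub>A\<^esub> b \<in> B"
    if "b \<in> B" "c \<in> B" for b c k
    using that subringE(6,7)[OF B(1)] A.submoduleE(4)[OF B(2)] by blast+
  have one_B: "\<one>\<^bsub>A\<^esub> \<in> B" using subringE(3)[OF B(1)] .
  note \<Phi>\<Delta> = linear_map_comp[OF comult_linear \<Phi>]

  have \<Delta>'_lin: "linear_map K Q TQ \<Delta>'"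
  proof (rule linear_mapI)
    fix p assume "p \<in> carrier Q"
    then obtain b where b: "b \<in> B" "p = \<rho> b" using Q_E by blast
    show "\<Delta>' p \<in> carrier TQ"
      using linear_map_closed[OF \<Phi>\<Delta> B_carrier[OF b(1)]] by (simp add: b \<Delta>'_\<rho>)
    show "\<Delta>' (k \<odot>\<^bsub>Q\<^esub> p) = k \<odot>\<^bsub>TQ\<^esub> \<Delta>' p" if k: "k \<in> carrier K" for k
      using linear_map_smult[OF \<Phi>\<Delta> k B_carrier[OF b(1)]] \<Delta>'_\<rho>[OF B_closed(3)[OF b(1,1) k]]
        linear_map_smult[OF \<rho> k B_carrier[OF b(1)]] \<Delta>'_\<rho>[OF b(1)] by (simp add: b(2))
    fix q assume "q \<in> carrier Q"
    then obtain c where c: "c \<in> B" "q = \<rho> c" using Q_E by blast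
    show "\<Delta>' (p \<oplus>\<^bsub>Q\<^esub> q) = \<Delta>' p \<oplus>\<^bsub>TQ\<^esub> \<Delta>' q"
      using linear_map_add[OF \<Phi>\<Delta> B_carrier[OF b(1)] B_carrier[OF c(1)]]
        \<Delta>'_\<rho>[OF B_closed(2)[OF b(1) c(1)]] \<Delta>'_\<rho>[OF b(1)] \<Delta>'_\<rho>[OF c(1)]
        linear_map_add[OF \<rho> B_carrier[OF b(1)] B_carrier[OF c(1)]] by (simp add: b(2) c(2))
  qed
  note \<epsilon>_hom = ring_hom_closed[OF A.counit_hom] ring_hom_mult[OF A.counit_hom]
    ring_hom_add[OF A.counit_hom] ring_hom_one[OF A.counit_hom]
  have \<epsilon>'_closed: "\<epsilon>' q \<in> carrier K" if q: "q \<in> carrier Q" for q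
    using Q_E[OF q] \<epsilon>'_\<rho> \<epsilon>_hom(1) B_carrier by auto
  have \<epsilon>'_mult: "\<epsilon>' (p \<otimes>\<^bsub>Q\<^esub> q) = \<epsilon>' p \<otimes>\<^bsub>K\<^esub> \<epsilon>' q"
    and \<epsilon>'_add: "\<epsilon>' (p \<oplus>\<^bsub>Q\<^esub> q) = \<epsilon>' p \<oplus>\<^bsub>K\<^esub> \<epsilon>' q" if p: "p \<in> carrier Q" and q: "q \<in> carrier Q" for p q
  proof -
    obtain b where b: "b \<in> B" "p = \<rho> b" using Q_E[OF p] by blast
    obtain c where c: "c \<in> B" "q = \<rho> c" using Q_E[OF q] by blast
    note carr = B_carrier[OF b(1)] B_carrier[OF c(1)]
    show "\<epsilon>' (p \<otimes>\<^bsub>Q\<^esub> q) = \<epsilon>' p \<otimes>\<^bsub>K\<^esub> \<epsilon>' q"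
      using \<epsilon>'_\<rho>[OF B_closed(1)[OF b(1) c(1)]] \<epsilon>'_\<rho>[OF b(1)] \<epsilon>'_\<rho>[OF c(1)] \<epsilon>_hom(2)[OF carr]
      by (simp add: b(2) c(2) \<rho>_mult[OF b(1) c(1)])
    show "\<epsilon>' (p \<oplus>\<^bsub>Q\<^esub> q) = \<epsilon>' p \<oplus>\<^bsub>K\<^esub> \<epsilon>' q"
      using \<epsilon>'_\<rho>[OF B_closed(2)[OF b(1) c(1)]] \<epsilon>'_\<rho>[OF b(1)] \<epsilon>'_\<rho>[OF c(1)] \<epsilon>_hom(3)[OF carr]
      by (simp add: b(2) c(2) linear_map_add[OF \<rho> carr])
  qed
  have \<epsilon>'_smult: "\<epsilon>' (k \<odot>\<^bsub>Q\<^esub> q) = k \<otimes>\<^bsub>K\<^esub> \<epsilon>' q" if k: "k \<in> carrier K" and q: "q \<in> carrier Q" for k q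
  proof -
    obtain b where b: "b \<in> B" "q = \<rho> b" using Q_E[OF q] by blast
    show ?thesis
      using \<epsilon>'_\<rho>[OF B_closed(3)[OF b(1,1) k]] \<epsilon>'_\<rho>[OF b(1)] A.counit_smult[OF k B_carrier[OF b(1)]]
      by (simp add: b(2) linear_map_smult[OF \<rho> k B_carrier[OF b(1)]])
  qed

  have comult_hom: "\<Delta>' \<in> ring_hom Q (tensor_algebra K Q Q)"
  proof (rule ring_hom_memI)
    fix p q assume p: "p \<in> carrier Q" and q: "q \<in> carrier Q"
    obtain b where b: "b \<in> B" "p = \<rho> b" using Q_E[OF p] by blast
    obtain c where c: "c \<in> B" "q = \<rho> c" using Q_E[OF q] by blast
    show "\<Delta>' (p \<otimes>\<^bsub>Q\<^esub> q) = \<Delta>' p \<otimes>\<^bsub>tensor_algebra K Q Q\<^esub> \<Delta>' q"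
      using \<Delta>'_\<rho>[OF B_closed(1)[OF b(1) c(1)]] \<Delta>'_\<rho>[OF b(1)] \<Delta>'_\<rho>[OF c(1)] \<Phi>_mult[OF b(1) c(1)]
        ring_hom_mult[OF A.comult_hom B_carrier[OF b(1)] B_carrier[OF c(1)]]
      by (simp add: b(2) c(2) \<rho>_mult[OF b(1) c(1)])
    show "\<Delta>' (p \<oplus>\<^bsub>Q\<^esub> q) = \<Delta>' p \<oplus>\<^bsub>tensor_algebra K Q Q\<^esub> \<Delta>' q"
      using linear_map_add[OF \<Delta>'_lin p q] by (simp add: tensor_algebra_simps)
  next
    show "\<Delta>' q \<in> carrier (tensor_algebra K Q Q)" if "q \<in> carrier Q" for q
      using linear_map_closed[OF \<Delta>'_lin that] by (simp add: tensor_algebra_simps)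
    show "\<Delta>' \<one>\<^bsub>Q\<^esub> = \<one>\<^bsub>tensor_algebra K Q Q\<^esub>"
      using \<Delta>'_\<rho>[OF one_B] ring_hom_one[OF A.comult_hom]
      by (simp add: \<rho>_one tensor_algebra_simps \<Phi>_pure)
  qed
  have counit_hom: "\<epsilon>' \<in> ring_hom Q K"
    using \<epsilon>'_\<rho>[OF one_B] \<epsilon>_hom(4)
    by (intro ring_hom_memI \<epsilon>'_closed \<epsilon>'_mult \<epsilon>'_add) (simp_all add: \<rho>_one)

  have id_A: "linear_map K A A id" and id_Q: "linear_map K Q Q id"
    unfolding id_def by (rule linear_map_id)+
  have coassoc: "tensor_assoc K Q Q Q (tensor_map K TQ Q \<Delta>' id (\<Delta>' q)) =
      tensor_map K Q TQ id \<Delta>' (\<Delta>' q)" if q: "q \<in> carrier Q" for q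
  proof -
    obtain b where b: "b \<in> B" "q = \<rho> b" using Q_E[OF q] by blast
    note b_carr = B_carrier[OF b(1)]
    note \<Delta>_id = linear_map_tensor_map[OF A_mod A_mod TA_mod A_mod comult_linear id_A]
      and \<Delta>_id_pure = tensor_map_pure[OF A_mod A_mod TA_mod A_mod comult_linear id_A]
    note id_\<Delta> = linear_map_tensor_map[OF A_mod A_mod A_mod TA_mod id_A comult_linear]
      and id_\<Delta>_pure = tensor_map_pure[OF A_mod A_mod A_mod TA_mod id_A comult_linear]
    note \<Delta>'_id = linear_map_tensor_map[OF Q_mod Q_mod TQ_mod Q_mod \<Delta>'_lin id_Q]
      and \<Delta>'_id_pure = tensor_map_pure[OF Q_mod Q_mod TQ_mod Q_mod \<Delta>'_lin id_Q]
    note id_\<Delta>' = linear_map_tensor_map[OF Q_mod Q_mod Q_mod TQ_mod id_Q \<Delta>'_lin]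
      and id_\<Delta>'_pure = tensor_map_pure[OF Q_mod Q_mod Q_mod TQ_mod id_Q \<Delta>'_lin]
    note \<Phi>_\<rho> = linear_map_tensor_map[OF TA_mod A_mod TQ_mod Q_mod \<Phi> \<rho>]
      and \<Phi>_\<rho>_pure = tensor_map_pure[OF TA_mod A_mod TQ_mod Q_mod \<Phi> \<rho>]
    note \<rho>_\<Phi> = linear_map_tensor_map[OF A_mod TA_mod Q_mod TQ_mod \<rho> \<Phi>]
      and \<rho>_\<Phi>_pure = tensor_map_pure[OF A_mod TA_mod Q_mod TQ_mod \<rho> \<Phi>]
    note \<Delta>_closed = linear_map_closed[OF comult_linear]
    note zero = bilinear_map_zero(1)[OF Q_mod TQ_mod module_tensor[OF Q_mod TQ_mod]
        bilinear_map_pure_tensor[OF Q_mod TQ_mod]]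
    (* On the left factor only elements of B occur in the generators, so both kinds of generators are
       covered by the defining property of the new coproduct. *)
    have left: "tensor_map K TQ Q \<Delta>' id (\<Phi> (\<Delta> b)) =
        tensor_map K TQ Q \<Phi> \<rho> (tensor_map K TA A \<Delta> id (\<Delta> b))"
      using I_sub B_carrier
      by (intro comult_eqI[OF module_tensor[OF TQ_mod Q_mod] linear_map_comp[OF \<Phi> \<Delta>'_id]
            linear_map_comp[OF \<Delta>_id \<Phi>_\<rho>] _ _ b(1)])
        (auto simp: \<Phi>_pure \<Delta>'_id_pure \<Delta>_id_pure \<Phi>_\<rho>_pure \<rho>_closed \<Delta>_closed \<Delta>'_\<rho>)
    (* Here the coproduct is applied to the right factor, which lies in B only for the first kind
       of generator; for the second kind the left factor is killed. *)
    have right: "tensor_map K Q TQ id \<Delta>' (\<Phi> (\<Delta> b)) =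
        tensor_map K Q TQ \<rho> \<Phi> (tensor_map K A TA id \<Delta> (\<Delta> b))"
      using I_carrier B_carrier linear_map_closed[OF \<Delta>'_lin] linear_map_closed[OF \<Phi>]
      by (intro comult_eqI[OF module_tensor[OF Q_mod TQ_mod] linear_map_comp[OF \<Phi> id_\<Delta>']
            linear_map_comp[OF id_\<Delta> \<rho>_\<Phi>] _ _ b(1)])
        (auto simp: \<Phi>_pure id_\<Delta>'_pure id_\<Delta>_pure \<rho>_\<Phi>_pure \<rho>_closed \<Delta>_closed \<Delta>'_\<rho> \<rho>_I zero)
    (* Both sides are now images of the two sides of coassociativity in A, by naturality of the
       associator. *)
    have "tensor_assoc K Q Q Q (tensor_map K TQ Q \<Delta>' id (\<Phi> (\<Delta> b))) =
        tensor_map K Q TQ \<rho> \<Phi> (tensor_assoc K A A A (tensor_map K TA A \<Delta> id (\<Delta> b)))"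
      unfolding left using linear_map_closed[OF \<Delta>_id \<Delta>_closed[OF b_carr]]
      by (intro tensor_assoc_natural A_mod Q_mod \<rho>)
    then show ?thesis
      by (simp add: b(2) \<Delta>'_\<rho>[OF b(1)] right A.coassoc[OF b_carr])
  qed

  note \<epsilon>_scale = bilinear_map_functional_smult[OF A_mod \<epsilon>_hom(1,3) A.counit_smult]
  note \<epsilon>'_scale = bilinear_map_functional_smult[OF Q_mod \<epsilon>'_closed \<epsilon>'_add \<epsilon>'_smult]
  have counit_left: "tensor_lift K Q (\<lambda>x y. \<epsilon>' x \<odot>\<^bsub>Q\<^esub> y) (\<Delta>' q) = q" if q: "q \<in> carrier Q" for q
  proof -
    obtain b where b: "b \<in> B" "q = \<rho> b" using Q_E[OF q] by blast
    note lift_A = linear_map_tensor_lift[OF A_mod A_mod A_mod \<epsilon>_scale]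
      and lift_A_pure = tensor_lift_pure[OF A_mod A_mod A_mod \<epsilon>_scale]
    note lift_Q = linear_map_tensor_lift[OF Q_mod Q_mod Q_mod \<epsilon>'_scale]
      and lift_Q_pure = tensor_lift_pure[OF Q_mod Q_mod Q_mod \<epsilon>'_scale]
    have "tensor_lift K Q (\<lambda>x y. \<epsilon>' x \<odot>\<^bsub>Q\<^esub> y) (\<Phi> (\<Delta> b)) =
        \<rho> (tensor_lift K A (\<lambda>x y. \<epsilon> x \<odot>\<^bsub>A\<^esub> y) (\<Delta> b))"
      using I_sub B_carrier
      by (intro comult_eqI[OF Q_mod linear_map_comp[OF \<Phi> lift_Q] linear_map_comp[OF lift_A \<rho>]
            _ _ b(1)])
        (auto simp: \<Phi>_pure lift_A_pure lift_Q_pure \<rho>_closed \<epsilon>'_\<rho> \<epsilon>_hom(1) linear_map_smult[OF \<rho>])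
    then show ?thesis
      using A.counit_left[OF B_carrier[OF b(1)]] by (simp add: b(2) \<Delta>'_\<rho>[OF b(1)])
  qed
  have counit_right: "tensor_lift K Q (\<lambda>x y. \<epsilon>' y \<odot>\<^bsub>Q\<^esub> x) (\<Delta>' q) = q" if q: "q \<in> carrier Q" for q
  proof -
    obtain b where b: "b \<in> B" "q = \<rho> b" using Q_E[OF q] by blast
    note lift_A = linear_map_tensor_lift[OF A_mod A_mod A_mod bilinear_map_flip[OF \<epsilon>_scale]]
      and lift_A_pure = tensor_lift_pure[OF A_mod A_mod A_mod bilinear_map_flip[OF \<epsilon>_scale]]
    note lift_Q = linear_map_tensor_lift[OF Q_mod Q_mod Q_mod bilinear_map_flip[OF \<epsilon>'_scale]]
      and lift_Q_pure = tensor_lift_pure[OF Q_mod Q_mod Q_mod bilinear_map_flip[OF \<epsilon>'_scale]]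
    have "tensor_lift K Q (\<lambda>x y. \<epsilon>' y \<odot>\<^bsub>Q\<^esub> x) (\<Phi> (\<Delta> b)) =
        \<rho> (tensor_lift K A (\<lambda>x y. \<epsilon> y \<odot>\<^bsub>A\<^esub> x) (\<Delta> b))"
      using I_carrier B_carrier
      by (intro comult_eqI[OF Q_mod linear_map_comp[OF \<Phi> lift_Q] linear_map_comp[OF lift_A \<rho>]
            _ _ b(1)])
        (auto simp: \<Phi>_pure lift_A_pure lift_Q_pure \<rho>_closed \<epsilon>'_\<rho> \<epsilon>_hom(1) linear_map_smult[OF \<rho>]
          \<rho>_I \<epsilon>'_closed)
    then show ?thesis
      using A.counit_right[OF B_carrier[OF b(1)]] by (simp add: b(2) \<Delta>'_\<rho>[OF b(1)])
  qed
  have "bialgebra K Q \<Delta>' \<epsilon>'"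
    by (intro bialgebra.intro bialgebra_axioms.intro Q comult_hom counit_hom
        linear_map_smult[OF \<Delta>'_lin] \<epsilon>'_smult coassoc counit_left counit_right)
  then show thesis using that \<Delta>'_\<rho> \<epsilon>'_\<rho> by blast
qed

end


section \<open>Subalgebras and their quotients\<close>

lemma unital_algebra_subalgebra:
  assumes "unital_algebra K A" "subring B A" "submodule B K A"
  shows "unital_algebra K (A\<lparr>carrier := B\<rparr>)"
proof -
  interpret A: unital_algebra K A by fact
  note B = subsetD[OF subringE(1)[OF assms(2)]]
  show ?thesis
    by (intro unital_algebra.intro unital_algebra_axioms.intro A.K.field_axioms
        submodule.submodule_is_module[OF assms(3) A.module_axioms] A.subring_is_ring assms(2))
      (simp_all add: B A.smult_mult_left A.smult_mult_right)
qed

text \<open>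
  An ideal is closed under scalars since \<open>k \<odot> i = (k \<odot> 1) i\<close>.
\<close>

lemma submodule_ideal:
  assumes "unital_algebra K C" "ideal I C"
  shows "submodule I K C"
proof -
  interpret C: unital_algebra K C by fact
  interpret I: ideal I C by fact
  show ?thesis
  proof (rule C.submoduleI)
    show "k \<odot>\<^bsub>C\<^esub> i \<in> I" if "k \<in> carrier K" "i \<in> I" for k i
    proof -
      have "(k \<odot>\<^bsub>C\<^esub> \<one>\<^bsub>C\<^esub>) \<otimes>\<^bsub>C\<^esub> i \<in> I" using that by (intro I.I_l_closed) auto
      then show ?thesis using that I.a_subset by (auto simp: C.smult_mult_left)
    qed
  qed (use I.a_subset in auto)
qed

lemma unital_algebra_quotient:
  assumes C: "unital_algebra K C" and I: "ideal I C"
  shows "unital_algebra K (quotient_mod C I)"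
proof -
  interpret C: unital_algebra K C by fact
  interpret I: ideal I C by fact
  note I_sub = submodule_ideal[OF assms]
  interpret Q: module K "quotient_mod C I"
    by (rule module_quotient_mod[OF C.module_axioms I_sub])
  note add = quotient_mod_add[OF C.module_axioms I_sub]
    and smult = quotient_mod_smult[OF C.module_axioms I_sub]
  have mult: "(I +>\<^bsub>C\<^esub> x) \<otimes>\<^bsub>quotient_mod C I\<^esub> (I +>\<^bsub>C\<^esub> y) = I +>\<^bsub>C\<^esub> (x \<otimes>\<^bsub>C\<^esub> y)"
    if "x \<in> carrier C" "y \<in> carrier C" for x y
    using I.rcoset_mult_add[OF that] by (simp add: quotient_mod_simps(4))
  have "ring (quotient_mod C I)"
    by (intro ringI Q.abelian_group_axioms monoidI)
      (auto simp: quotient_mod_simps(1,3) mult add C.m_assoc C.l_distr C.r_distr)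
  then show ?thesis
    by (intro unital_algebra.intro unital_algebra_axioms.intro C.K.field_axioms Q.module_axioms)
      (auto simp: quotient_mod_simps(1) mult smult C.smult_mult_left C.smult_mult_right)
qed

text \<open>
  Left inverses of \<open>f\<close> and \<open>g\<close> tensor to a left inverse of \<open>f \<otimes> g\<close>.
\<close>

lemma inj_on_tensor_map:
  assumes V: "module K V" "module K W" and V': "module K V'" "module K W'"
    and f: "linear_map K V V' f" and g: "linear_map K W W' g"
    and r: "linear_map K V' V r" "\<And>v. v \<in> carrier V \<Longrightarrow> r (f v) = v"
    and s: "linear_map K W' W s" "\<And>w. w \<in> carrier W \<Longrightarrow> s (g w) = w"
  shows "inj_on (tensor_map K V' W' f g) (carrier (tensor K V W))"
proof (rule inj_on_inverseI)
  show "tensor_map K V W r s (tensor_map K V' W' f g t) = t" if "t \<in> carrier (tensor K V W)" for t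
    by (rule tensor_eqI[OF V module_tensor[OF V] linear_map_comp[OF
            linear_map_tensor_map[OF V V' f g] linear_map_tensor_map[OF V' V r(1) s(1)]]
          linear_map_id _ that])
      (simp add: tensor_map_pure[OF V V' f g] tensor_map_pure[OF V' V r(1) s(1)] r(2) s(2)
        linear_map_closed[OF f] linear_map_closed[OF g])
qed


section \<open>The induced bialgebra\<close>

theorem proposition1p1:
  fixes K :: "('k, 'r) ring_scheme" and A :: "('k, 'a, 'm) module_scheme"
    and \<Delta> :: "'a \<Rightarrow> ('a \<times> 'a \<Rightarrow> 'k) set" and \<epsilon> :: "'a \<Rightarrow> 'k"
    and B I :: "'a set"
  defines "T \<equiv> tensor K A A"
    and "AI \<equiv> quotient_mod A I"
    and "BI \<equiv> quotient_mod (A\<lparr>carrier := B\<rparr>) I"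
    and "\<pi> \<equiv> (\<lambda>a. I +>\<^bsub>A\<^esub> a)"
  defines "\<iota> \<equiv> tensor_map K AI AI id id"
  assumes "bialgebra K A \<Delta> \<epsilon>"
    and "subring B A" and "submodule B K A"
    and "ideal I (A\<lparr>carrier := B\<rparr>)"
    and "I \<subseteq> B \<inter> {a \<in> carrier A. \<epsilon> a = \<zero>\<^bsub>K\<^esub>}"
    and "\<Delta> ` B \<subseteq> tensor_subspace K A A B B <+>\<^bsub>T\<^esub> tensor_subspace K A A I (carrier A)"
    and "\<Delta> ` I \<subseteq> tensor_subspace K A A B I <+>\<^bsub>T\<^esub> tensor_subspace K A A I (carrier A)"
  shows "inj_on \<iota> (carrier (tensor K BI BI)) \<and>
    (\<exists>\<Delta>' \<epsilon>'. bialgebra K BI \<Delta>' \<epsilon>' \<and>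
      (\<forall>b\<in>B. \<iota> (\<Delta>' (\<pi> b)) = tensor_map K AI AI \<pi> \<pi> (\<Delta> b) \<and> \<epsilon>' (\<pi> b) = \<epsilon> b))"
proof -
  note bialg = assms(6) and B = assms(7,8) and I = assms(9)
  let ?C = "A\<lparr>carrier := B\<rparr>"
  interpret A: bialgebra K A \<Delta> \<epsilon> by (rule bialg)
  have C: "unital_algebra K ?C"
    by (rule unital_algebra_subalgebra[OF A.unital_algebra_axioms B])
  interpret C: unital_algebra K ?C by (rule C)
  have I_sub_C: "submodule I K ?C" by (rule submodule_ideal[OF C I])
  note I_closed = C.submoduleE[OF I_sub_C]
  have IB: "I \<subseteq> B" using assms(10) by blast
  have BA: "b \<in> carrier A" if "b \<in> B" for b using subringE(1)[OF B(1)] that by blast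
  have IA: "i \<in> carrier A" if "i \<in> I" for i using IB BA that by blast
  have I_sub: "submodule I K A"
  proof (rule A.submoduleI)
    show "I \<subseteq> carrier A" using IA by blast
    show "\<zero>\<^bsub>A\<^esub> \<in> I" using subgroup.one_closed[OF submodule.axioms(1)[OF I_sub_C]] by simp
    show "i \<oplus>\<^bsub>A\<^esub> j \<in> I" if "i \<in> I" "j \<in> I" for i j using I_closed(5)[OF that] by simp
    show smult: "k \<odot>\<^bsub>A\<^esub> i \<in> I" if "k \<in> carrier K" "i \<in> I" for k i
      using I_closed(4)[OF that] by simp
    show "\<ominus>\<^bsub>A\<^esub> i \<in> I" if "i \<in> I" for i
      using smult[OF _ that, of "\<ominus>\<^bsub>K\<^esub> \<one>\<^bsub>K\<^esub>"] IA[OF that] by (simp add: A.smult_l_minus)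
  qed
  have AI_mod: "module K AI"
    unfolding AI_def by (rule module_quotient_mod[OF A.module_axioms I_sub])
  have \<pi>: "linear_map K A AI \<pi>"
    unfolding AI_def \<pi>_def by (rule linear_map_quotient[OF A.module_axioms I_sub])
  have BI: "unital_algebra K BI"
    unfolding BI_def by (rule unital_algebra_quotient[OF C I])
  note BI_mod = unital_algebra.axioms(2)[OF BI]
  have BI_AI: "BI = AI\<lparr>carrier := \<pi> ` B\<rparr>"
    unfolding BI_def AI_def \<pi>_def by (rule quotient_mod_restrict_carrier)
  interpret AI: module K AI by (rule AI_mod)
  have "submodule (\<pi> ` B) K AI"
    using BI_mod linear_map_closed[OF \<pi> BA] unfolding BI_AI
    by (intro AI.module_incl_imp_submodule) auto
  then obtain r where r: "linear_map K AI BI r" and r_id: "\<And>w. w \<in> \<pi> ` B \<Longrightarrow> r w = w"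
    unfolding BI_AI using linear_retraction[OF A.K.field_axioms AI_mod] by blast
  have incl: "linear_map K BI AI id"
    using linear_map_closed[OF \<pi> BA] by (intro linear_mapI) (auto simp: BI_AI)
  have "inj_on \<iota> (carrier (tensor K BI BI))"
    unfolding \<iota>_def
    by (rule inj_on_tensor_map[OF BI_mod BI_mod AI_mod AI_mod incl incl r _ r])
      (simp_all add: BI_AI r_id)

  (* On B this is the quotient map; the retraction extends it to A with values still in B/I. *)
  define \<rho> where "\<rho> a = r (\<pi> a)" for a
  have \<rho>_B: "\<rho> b = \<pi> b" if "b \<in> B" for b
    using that by (simp add: \<rho>_def r_id)
  have \<rho>: "linear_map K A BI \<rho>"
    unfolding \<rho>_def by (rule linear_map_comp[OF \<pi> r])
  have \<pi>_C: "\<pi> b = I +>\<^bsub>?C\<^esub> b" for b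
    by (simp add: \<pi>_def a_r_coset_def')
  interpret I: ideal I ?C by (rule I)
  have zero: "\<zero>\<^bsub>BI\<^esub> = I" by (simp add: BI_def quotient_mod_simps)
  interpret S: bialgebra_subquotient K A \<Delta> \<epsilon> B I BI \<rho>
  proof (rule bialgebra_subquotient.intro)
    show "\<rho> ` B = carrier BI" using \<rho>_B by (simp add: BI_AI cong: image_cong)
    show "\<rho> \<one>\<^bsub>A\<^esub> = \<one>\<^bsub>BI\<^esub>"
      using \<rho>_B[OF subringE(3)[OF B(1)]] by (simp add: BI_def quotient_mod_simps \<pi>_C)
    show "\<rho> (b \<otimes>\<^bsub>A\<^esub> c) = \<rho> b \<otimes>\<^bsub>BI\<^esub> \<rho> c" if "b \<in> B" "c \<in> B" for b c
      using I.rcoset_mult_add[of b c] that subringE(6)[OF B(1) that]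
      by (simp add: \<rho>_B \<pi>_C BI_def quotient_mod_simps(4))
    show "\<rho> b = \<zero>\<^bsub>BI\<^esub> \<longleftrightarrow> b \<in> I" if "b \<in> B" for b
      using I.a_rcos_self[of b] I.a_rcos_const[of b] that by (auto simp: \<rho>_B \<pi>_C zero)
  qed (use bialg BI B IB \<rho> assms(10-12) in \<open>auto simp: T_def\<close>)
  obtain \<Delta>' \<epsilon>' where bialg': "bialgebra K BI \<Delta>' \<epsilon>'"
    and \<Delta>': "\<And>b. b \<in> B \<Longrightarrow> \<Delta>' (\<rho> b) = tensor_map K BI BI \<rho> \<rho> (\<Delta> b)"
    and \<epsilon>': "\<And>b. b \<in> B \<Longrightarrow> \<epsilon>' (\<rho> b) = \<epsilon> b"
    using S.bialgebra_image by blast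
  have "\<iota> (\<Delta>' (\<pi> b)) = tensor_map K AI AI \<pi> \<pi> (\<Delta> b)" if b: "b \<in> B" for b
  proof -
    note \<iota> = linear_map_tensor_map[OF BI_mod BI_mod AI_mod AI_mod incl incl]
      and \<iota>_pure = tensor_map_pure[OF BI_mod BI_mod AI_mod AI_mod incl incl]
    note \<pi>\<pi> = linear_map_tensor_map[OF A.module_axioms A.module_axioms AI_mod AI_mod \<pi> \<pi>]
      and \<pi>\<pi>_pure = tensor_map_pure[OF A.module_axioms A.module_axioms AI_mod AI_mod \<pi> \<pi>]
    note pure_zero = bilinear_map_zero(1)[OF AI_mod AI_mod module_tensor[OF AI_mod AI_mod]
        bilinear_map_pure_tensor[OF AI_mod AI_mod]]
    have AI_zero: "\<zero>\<^bsub>BI\<^esub> = \<zero>\<^bsub>AI\<^esub>" by (simp add: BI_AI)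
    have \<rho>_AI: "\<rho> a \<in> carrier AI" if "a \<in> carrier A" for a
      using linear_map_closed[OF incl linear_map_closed[OF \<rho> that]] by simp
    have \<pi>_I: "\<pi> i = \<zero>\<^bsub>AI\<^esub>" if "i \<in> I" for i
      using S.\<rho>_I[OF that] \<rho>_B that IB by (auto simp: AI_zero)
    have \<iota>_\<Phi>_pure: "tensor_map K AI AI id id (tensor_map K BI BI \<rho> \<rho> (pure_tensor K A A x y)) =
        pure_tensor K AI AI (\<rho> x) (\<rho> y)" if "x \<in> carrier A" "y \<in> carrier A" for x y
      using that linear_map_closed[OF \<rho>] by (simp add: S.\<Phi>_pure \<iota>_pure)
    have "\<iota> (tensor_map K BI BI \<rho> \<rho> (\<Delta> b)) = tensor_map K AI AI \<pi> \<pi> (\<Delta> b)"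
      unfolding \<iota>_def using BA IA linear_map_closed[OF \<pi>]
      by (intro S.comult_eqI[OF module_tensor[OF AI_mod AI_mod] linear_map_comp[OF S.\<Phi> \<iota>] \<pi>\<pi> _ _ b])
        (simp_all add: \<iota>_\<Phi>_pure \<pi>\<pi>_pure \<rho>_B S.\<rho>_I \<pi>_I AI_zero pure_zero \<rho>_AI)
    then show ?thesis
      using \<Delta>'[OF b] by (simp add: \<rho>_B[OF b])
  qed
  moreover have "\<epsilon>' (\<pi> b) = \<epsilon> b" if "b \<in> B" for b
    using \<epsilon>'[OF that] by (simp add: \<rho>_B[OF that])
  ultimately show ?thesis
    using \<open>inj_on \<iota> (carrier (tensor K BI BI))\<close> bialg' by blast
qed

end
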